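(* Let $\Phi$ be an irreducible reduced root system in a Euclidean space $E$ of dimension $\ell$, with Weyl group $W$ and Coxeter number $h$. Define $\delta : W \to \mathbb{C}$ by $\delta(w) := (-1)^{\ell - r(w)}$, where $r(w)$ is the dimension of the subspace $\{x \in E : w(x) = x\}$ of $E$ fixed by $w$. Then, as an identity of quasi-polynomials in $q$ with values in functions on $W$, $$\chi_{\Phi,q} = (-1)^{\ell}\cdot \delta \cdot \chi_{\Phi,h-q},$$ that is, $\chi_{\Phi,q}(w) = (-1)^{\ell}\,\delta(w)\,\chi_{\Phi,h-q}(w)$ for all $w \in W$ and all integers $q$.
   Context: Let $(\cdot,\cdot)$ be the inner product of $E$; root systems are crystallographic and span $E$. The coweight lattice of $\Phi$ is $Z := \{x \in E : (\alpha,x) \in \mathbb{Z} \text{ for all } \alpha \in \Phi\}$. For a positive integer $q$, put $$M(\Phi;q) := \{x + qZ \in Z/qZ : (\beta,x) \not\equiv 0 \pmod q \text{ for all } \beta \in \Phi\}.$$ The Weyl group $W$ acts on $Z/qZ$ by $w(x+qZ) = w(x)+qZ$ and preserves $M(\Phi;q)$. For $q \in \mathbb{Z}_{>0}$, $\chi_{\Phi,q}$ denotes the permutation character of $W$ on $M(\Phi;q)$: $\chi_{\Phi,q}(w) = \#\{t \in M(\Phi;q) : w(t) = t\}$. It is known that for each $w\in W$ the function $q \mapsto \chi_{\Phi,q}(w)$ on $\mathbb{Z}_{>0}$ is a quasi-polynomial: there are a positive integer $\tilde n$ and polynomials $f^{(1)},\dots,f^{(\tilde n)}$ with $\chi_{\Phi,q}(w)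 = f^{(r)}(q)$ whenever $q \equiv r \pmod{\tilde n}$. For integers $q \le 0$, $\chi_{\Phi,q}(w)$ is defined by this same formula. The Coxeter number is $h = 1 + n_1 + \cdots + n_\ell$, where $\tilde\alpha = n_1\alpha_1 + \cdots + n_\ell \alpha_\ell$ is the highest root expressed in simple roots. *)

theory Defs
  imports "HOL-Analysis.Analysis" "HOL-Computational_Algebra.Polynomial"
begin

text \<open>The Euclidean space \<open>E\<close> is the whole type \<open>'a::euclidean_space\<close>, of dimension \<open>DIM('a)\<close>.\<close>

definition refl_along :: "'a::euclidean_space \<Rightarrow> 'a \<Rightarrow> 'a" where
  "refl_along \<alpha> x = x - (2 * (x \<bullet> \<alpha>) / (\<alpha> \<bullet> \<alpha>)) *\<^sub>R \<alpha>"

definition root_system :: "'a::euclidean_space set \<Rightarrow> bool" where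
  "root_system \<Phi> \<longleftrightarrow>
     finite \<Phi> \<and> span \<Phi> = UNIV \<and> 0 \<notin> \<Phi> \<and>
     (\<forall>\<alpha>\<in>\<Phi>. \<forall>\<beta>\<in>\<Phi>. refl_along \<alpha> \<beta> \<in> \<Phi>) \<and>
     (\<forall>\<alpha>\<in>\<Phi>. \<forall>\<beta>\<in>\<Phi>. 2 * (\<beta> \<bullet> \<alpha>) / (\<alpha> \<bullet> \<alpha>) \<in> \<int>)"

definition reduced_roots :: "'a::euclidean_space set \<Rightarrow> bool" where
  "reduced_roots \<Phi> \<longleftrightarrow> (\<forall>\<alpha>\<in>\<Phi>. \<forall>c. c *\<^sub>R \<alpha> \<in> \<Phi> \<longrightarrow> c = 1 \<or> c = -1)"

definition irreducible_roots :: "'a::euclidean_space set \<Rightarrow> bool" where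
  "irreducible_roots \<Phi> \<longleftrightarrow>
     \<Phi> \<noteq> {} \<and>
     \<not> (\<exists>A B. A \<noteq> {} \<and> B \<noteq> {} \<and> A \<inter> B = {} \<and> \<Phi> = A \<union> B \<and> (\<forall>a\<in>A. \<forall>b\<in>B. a \<bullet> b = 0))"

text \<open>Reflections are involutions, so the monoid they generate under composition is the group
  they generate.\<close>

inductive_set weyl_group :: "'a::euclidean_space set \<Rightarrow> ('a \<Rightarrow> 'a) set"
  for \<Phi> :: "'a set" where
  weyl_id: "id \<in> weyl_group \<Phi>"
| weyl_refl: "\<alpha> \<in> \<Phi> \<Longrightarrow> w \<in> weyl_group \<Phi> \<Longrightarrow> refl_along \<alpha> \<circ> w \<in> weyl_group \<Phi>"

definition simple_roots :: "'a::euclidean_space set \<Rightarrow> 'a set \<Rightarrow> bool" where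
  "simple_roots \<Phi> \<Delta> \<longleftrightarrow>
     \<Delta> \<subseteq> \<Phi> \<and> independent \<Delta> \<and> span \<Delta> = UNIV \<and>
     (\<forall>\<beta>\<in>\<Phi>. \<exists>c::'a \<Rightarrow> nat.
        \<beta> = (\<Sum>\<alpha>\<in>\<Delta>. real (c \<alpha>) *\<^sub>R \<alpha>) \<or> \<beta> = - (\<Sum>\<alpha>\<in>\<Delta>. real (c \<alpha>) *\<^sub>R \<alpha>))"

definition highest_root :: "'a::euclidean_space set \<Rightarrow> 'a set \<Rightarrow> 'a \<Rightarrow> bool" where
  "highest_root \<Phi> \<Delta> \<theta> \<longleftrightarrow>
     \<theta> \<in> \<Phi> \<and> (\<forall>\<beta>\<in>\<Phi>. \<exists>c::'a \<Rightarrow> nat. \<theta> - \<beta> = (\<Sum>\<alpha>\<in>\<Delta>. real (c \<alpha>) *\<^sub>R \<alpha>))"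

text \<open>Stated as a relation because it refers to a choice of simple roots; an irreducible reduced
  root system has exactly one Coxeter number, whichever simple roots are chosen.\<close>

definition is_coxeter_number :: "'a::euclidean_space set \<Rightarrow> int \<Rightarrow> bool" where
  "is_coxeter_number \<Phi> h \<longleftrightarrow>
     (\<exists>\<Delta> \<theta>. \<exists>n::'a \<Rightarrow> int.
        simple_roots \<Phi> \<Delta> \<and> highest_root \<Phi> \<Delta> \<theta> \<and>
        \<theta> = (\<Sum>\<alpha>\<in>\<Delta>. of_int (n \<alpha>) *\<^sub>R \<alpha>) \<and> h = 1 + (\<Sum>\<alpha>\<in>\<Delta>. n \<alpha>))"

definition coweight_lattice :: "'a::euclidean_space set \<Rightarrow> 'a set" where
  "coweight_lattice \<Phi> = {x. \<forall>\<alpha>\<in>\<Phi>. \<alpha> \<bullet> x \<in> \<int>}"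

definition coweight_coset :: "'a::euclidean_space set \<Rightarrow> int \<Rightarrow> 'a \<Rightarrow> 'a set" where
  "coweight_coset \<Phi> q x = (\<lambda>z. x + of_int q *\<^sub>R z) ` coweight_lattice \<Phi>"

definition M_set :: "'a::euclidean_space set \<Rightarrow> int \<Rightarrow> 'a set set" where
  "M_set \<Phi> q =
     {coweight_coset \<Phi> q x | x.
        x \<in> coweight_lattice \<Phi> \<and> (\<forall>\<beta>\<in>\<Phi>. \<not> (\<exists>k::int. \<beta> \<bullet> x = of_int (q * k)))}"

text \<open>The action of \<open>w\<close> on a coset \<open>t\<close> is the image \<open>w ` t\<close>; it agrees with the action on
  representatives.\<close>

lemma weyl_group_linear: "w \<in> weyl_group \<Phi> \<Longrightarrow> linear w"
proof (induction rule: weyl_group.induct)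
  case weyl_id
  show ?case by (simp add: id_def linear_iff)
next
  case (weyl_refl \<alpha> w)
  have "linear (refl_along \<alpha>)"
    by (rule linearI)
       (simp_all add: refl_along_def inner_add_left scaleR_add_left scaleR_diff_right
          add_divide_distrib distrib_left)
  with weyl_refl show ?case by (blast intro: linear_compose)
qed

lemma refl_along_involution: "refl_along \<alpha> (refl_along \<alpha> x) = x"
  by (cases "\<alpha> = 0") (simp_all add: refl_along_def inner_diff_left diff_divide_distrib)

lemma refl_along_adjoint: "refl_along \<alpha> x \<bullet> y = x \<bullet> refl_along \<alpha> y"
  by (simp add: refl_along_def inner_diff_left inner_diff_right inner_commute)

lemma weyl_group_coweight_lattice:
  assumes "root_system \<Phi>" "w \<in> weyl_group \<Phi>"
  shows "w ` coweight_lattice \<Phi> = coweight_lattice \<Phi>"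
  using assms(2)
proof (induction rule: weyl_group.induct)
  case weyl_id
  show ?case by simp
next
  case (weyl_refl \<alpha> w)
  have sub: "refl_along \<alpha> x \<in> coweight_lattice \<Phi>" if "x \<in> coweight_lattice \<Phi>" for x
    using that assms(1) weyl_refl.hyps(1)
    unfolding coweight_lattice_def root_system_def
    by (auto simp flip: refl_along_adjoint)
  have "refl_along \<alpha> ` coweight_lattice \<Phi> = coweight_lattice \<Phi>"
  proof
    show "coweight_lattice \<Phi> \<subseteq> refl_along \<alpha> ` coweight_lattice \<Phi>"
      using sub refl_along_involution by (metis image_eqI subsetI)
  qed (use sub in blast)
  with weyl_refl.IH show ?case by (metis image_comp)
qed

lemma weyl_group_coset_action:
  assumes "root_system \<Phi>" "w \<in> weyl_group \<Phi>"
  shows "w ` coweight_coset \<Phi> q x = coweight_coset \<Phi> q (w x)"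
proof -
  have "w ` coweight_coset \<Phi> q x = (\<lambda>z. w x + of_int q *\<^sub>R z) ` (w ` coweight_lattice \<Phi>)"
    using weyl_group_linear [OF assms(2)]
    by (simp add: coweight_coset_def image_image linear_add linear_cmul)
  then show ?thesis
    by (simp add: weyl_group_coweight_lattice [OF assms] coweight_coset_def)
qed

definition fixed_count :: "'a::euclidean_space set \<Rightarrow> int \<Rightarrow> ('a \<Rightarrow> 'a) \<Rightarrow> nat" where
  "fixed_count \<Phi> q w = card {t \<in> M_set \<Phi> q. w ` t = t}"

definition quasi_polynomial :: "(int \<Rightarrow> complex) \<Rightarrow> bool" where
  "quasi_polynomial g \<longleftrightarrow>
     (\<exists>n>0. \<exists>f::int \<Rightarrow> complex poly. \<forall>q. g q = poly (f (q mod n)) (of_int q))"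

lemma quasi_polynomial_eqI:
  assumes "quasi_polynomial g" "quasi_polynomial g'" "\<And>q. q > 0 \<Longrightarrow> g q = g' q"
  shows "g = g'"
proof
  fix q
  obtain n f where n: "n > 0" and f: "\<And>q. g q = poly (f (q mod n)) (of_int q)"
    using assms(1) unfolding quasi_polynomial_def by blast
  obtain n' f' where n': "n' > 0" and f': "\<And>q. g' q = poly (f' (q mod n')) (of_int q)"
    using assms(2) unfolding quasi_polynomial_def by blast
  define p where "p = f (q mod n) - f' (q mod n')"
  define s where "s k = q + (\<bar>q\<bar> + 1 + int k) * (n * n')" for k :: nat
  have pos: "s k > 0" for k
  proof -
    have "(\<bar>q\<bar> + 1 + int k) * 1 \<le> (\<bar>q\<bar> + 1 + int k) * (n * n')"
      using n n' by (intro mult_left_mono) (auto simp: int_one_le_iff_zero_less)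
    then show ?thesis by (simp add: s_def)
  qed
  have "s k mod n = q mod n" "s k mod n' = q mod n'" for k
    unfolding s_def by (metis mod_mult_self1 mult.assoc mult.commute)+
  then have "poly p (of_int (s k)) = 0" for k
    using f [of "s k"] f' [of "s k"] assms(3) [OF pos [of k]] by (simp add: p_def)
  then have "range (\<lambda>k. of_int (s k)) \<subseteq> {x. poly p x = 0}" by auto
  moreover have "inj (\<lambda>k. of_int (s k) :: complex)"
    using n n' by (auto simp: inj_def s_def simp del: of_int_add of_int_mult)
  then have "infinite (range (\<lambda>k. of_int (s k) :: complex))"
    by (rule range_inj_infinite)
  ultimately have "p = 0"
    using poly_roots_finite finite_subset by blast
  then show "g q = g' q"
    using f f' by (simp add: p_def)
qed

text \<open>For \<open>q \<le> 0\<close> the character is the value at \<open>q\<close> of the quasi-polynomial that agrees with the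
  fixed-point count at all positive integers; it is unique by \<open>quasi_polynomial_eqI\<close>.\<close>

definition chi :: "'a::euclidean_space set \<Rightarrow> int \<Rightarrow> ('a \<Rightarrow> 'a) \<Rightarrow> complex" where
  "chi \<Phi> q w =
     (if q > 0 then of_nat (fixed_count \<Phi> q w)
      else (THE g. quasi_polynomial g \<and> (\<forall>p>0. g p = of_nat (fixed_count \<Phi> p w))) q)"

text \<open>The natural-number subtraction does not truncate, as a subspace has dimension at most
  \<open>DIM('a)\<close>.\<close>

definition delta :: "('a::euclidean_space \<Rightarrow> 'a) \<Rightarrow> complex" where
  "delta w = (-1) ^ (DIM('a) - dim {x. w x = x})"

end

theory Submission
  imports Defs "HOL-Library.Multiset"
begin

text \<open>
  The count of fixed points is moved from \<open>Z/qZ\<close> to the lattice points of a dilated alcove, where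
  the affine Dynkin diagram turns it into a count of solutions of one linear equation; the symmetry
  \<open>q \<leftrightarrow> h - q\<close> is then the classical reciprocity for such counts.

  Let \<open>Z\<close> be the coweight lattice, \<open>\<theta>\<close> the highest root, and \<open>A(q)\<close> the set of \<open>y \<in> Z\<close> with
  \<open>\<alpha> \<bullet> y > 0\<close> for all simple \<open>\<alpha>\<close> and \<open>\<theta> \<bullet> y < q\<close>. Moving a regular point by reflections towards a
  point inside the alcove shows that every class in \<open>M(\<Phi>;q)\<close> has the form \<open>u(y) + qZ\<close> with
  \<open>u \<in> W\<close> and \<open>y \<in> A(q)\<close> (\<open>alcove_representative\<close>). If \<open>y, y' \<in> A(q)\<close> and \<open>y' \<equiv> v(y)\<close> modulo \<open>qZ\<close>
  with \<open>v \<in> W\<close>, then \<open>v\<close> permutes the extended base, which consists of the simple roots and \<open>-\<theta>\<close>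
  (\<open>diagram_groupI\<close>): the extended base is the set of roots that are indecomposable in a sense that
  can be read off from the residues of the numbers \<open>\<beta> \<bullet> y\<close> modulo \<open>q\<close>, and congruent points have the
  same residues. Hence the pairs \<open>(u, y)\<close> that give the same class correspond to the group \<open>\<Omega>\<close> of
  the \<open>v \<in> W\<close> that permute the extended base, and
  \<open>|\<Omega>| \<cdot> \<chi>(w) = \<Sum>\<^sub>u #{y \<in> A(q). (u\<^sup>-\<^sup>1 w u) y \<equiv> y}\<close> (\<open>fixed_count_alcove\<close>).

  Fix \<open>v = u\<^sup>-\<^sup>1 w u\<close>. Outside \<open>\<Omega>\<close> its summand is zero. For \<open>v \<in> \<Omega>\<close> the residues at the
  extended base are positive integer coordinates on \<open>A(q)\<close>, subject to the single equation
  \<open>\<Sum> n\<^sub>a x\<^sub>a = q\<close> with \<open>n\<^sub>a\<close> the marks of the affine diagram, and a point is fixed by \<open>v\<close> modulo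
  \<open>qZ\<close> exactly when its coordinates are constant on the orbits of \<open>v\<close>. The summand is therefore the
  number of positive solutions of \<open>\<Sum> m\<^sub>c x\<^sub>c = q\<close>, where \<open>c\<close> runs over the orbits and \<open>m\<^sub>c\<close> is the sum
  of the marks in \<open>c\<close> (\<open>card_alcove_fixed\<close>). For \<open>k\<close> orbits this is a quasi-polynomial \<open>g\<close> in \<open>q\<close> with
  \<open>g(\<Sum> m\<^sub>c - q) = (-1)\<^sup>k\<^sup>-\<^sup>1 g(q)\<close> (\<open>denumerant_reciprocity\<close>). The marks add up to \<open>h\<close>, and
  \<open>k - 1\<close> is the dimension of the fixed space of \<open>v\<close> (\<open>dim_fixed_space\<close>), hence of that of the conjugate
  element \<open>w\<close>. So all summands obey the same reciprocity, and its sign \<open>(-1)\<^sup>r\<^sup>(\<^sup>w\<^sup>)\<close> equals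
  \<open>(-1)\<^sup>l \<delta>(w)\<close>, where \<open>l\<close> is the dimension of the space.
\<close>

section \<open>Quasi-polynomials\<close>

lemma quasi_polynomial_common_period:
  assumes "n > 0" "\<And>q. g q = poly (f (q mod n)) (of_int q)" "k > 0"
  shows "\<exists>f'. \<forall>q. g q = poly (f' (q mod (n * k))) (of_int q)"
proof
  show "\<forall>q. g q = poly ((\<lambda>r. f (r mod n)) (q mod (n * k))) (of_int q)"
    using assms by (simp add: mod_mult2_eq mod_mod_cancel)
qed

lemma quasi_polynomial_add:
  assumes "quasi_polynomial g" "quasi_polynomial g'"
  shows "quasi_polynomial (\<lambda>q. g q + g' q)"
proof -
  obtain n f where n: "n > 0" "\<And>q. g q = poly (f (q mod n)) (of_int q)"
    using assms(1) unfolding quasi_polynomial_def by blast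
  obtain n' f' where n': "n' > 0" "\<And>q. g' q = poly (f' (q mod n')) (of_int q)"
    using assms(2) unfolding quasi_polynomial_def by blast
  obtain F where F: "\<And>q. g q = poly (F (q mod (n * n'))) (of_int q)"
    using quasi_polynomial_common_period [OF n n'(1)] by blast
  obtain F' where F': "\<And>q. g' q = poly (F' (q mod (n * n'))) (of_int q)"
    using quasi_polynomial_common_period [OF n' n(1)] by (auto simp: mult.commute)
  show ?thesis
    unfolding quasi_polynomial_def
    using n(1) n'(1) F F'
    by (intro exI[of _ "n * n'"] conjI exI[of _ "\<lambda>r. F r + F' r"]) auto
qed

lemma quasi_polynomial_cmult:
  assumes "quasi_polynomial g"
  shows "quasi_polynomial (\<lambda>q. c * g q)"
proof -
  obtain n f where n: "n > 0" "\<And>q. g q = poly (f (q mod n)) (of_int q)"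
    using assms(1) unfolding quasi_polynomial_def by blast
  then show ?thesis
    unfolding quasi_polynomial_def
    by (intro exI[of _ n] conjI exI[of _ "\<lambda>r. smult c (f r)"]) auto
qed

lemma quasi_polynomial_zero: "quasi_polynomial (\<lambda>q. 0)"
  unfolding quasi_polynomial_def by (intro exI[of _ 1] conjI exI[of _ "\<lambda>r. 0"]) auto

lemma quasi_polynomial_sum:
  assumes "\<And>i. i \<in> I \<Longrightarrow> quasi_polynomial (g i)"
  shows "quasi_polynomial (\<lambda>q. \<Sum>i\<in>I. g i q)"
  using assms
  by (induction I rule: infinite_finite_induct)
    (auto intro: quasi_polynomial_add quasi_polynomial_zero)

definition gbinomial_poly :: "nat \<Rightarrow> complex poly" where
  "gbinomial_poly k = smult (inverse (fact k)) (\<Prod>i = 0..<k. [:- of_nat i, 1:])"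

lemma poly_gbinomial_poly: "poly (gbinomial_poly k) x = x gchoose k"
  by (simp add: gbinomial_poly_def poly_prod gbinomial_prod_rev divide_inverse mult.commute)

lemma quasi_polynomial_gbinomial:
  assumes "N > 0"
  shows "quasi_polynomial
    (\<lambda>q. if N dvd q - a then (of_int ((q - a) div N) + b) gchoose k else 0)"
proof -
  let ?f = "\<lambda>r. if N dvd r - a
    then pcompose (gbinomial_poly k) [:b - of_int a / of_int N, 1 / of_int N:] else 0"
  have "N dvd q mod N - a \<longleftrightarrow> N dvd q - a" for q
    by (simp add: mod_eq_dvd_iff [symmetric])
  moreover have "of_int ((q - a) div N) = (of_int q - of_int a) / (of_int N :: complex)"
    if "N dvd q - a" for q
    using that assms by (auto simp: dvd_def simp flip: of_int_diff)
  moreover have "poly (pcompose (gbinomial_poly k) [:b - of_int a / of_int N, 1 / of_int N:])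
      (of_int q) = ((of_int q - of_int a) / of_int N + b) gchoose k" for q
    by (simp add: poly_pcompose poly_gbinomial_poly diff_divide_distrib algebra_simps)
  ultimately have "(if N dvd q - a then (of_int ((q - a) div N) + b) gchoose k else 0) =
      poly (?f (q mod N)) (of_int q)" for q
    by simp
  then show ?thesis
    unfolding quasi_polynomial_def using assms
    by (intro exI [of _ N] conjI exI [of _ ?f] allI)
qed

section \<open>Reciprocity for denumerants\<close>

definition denumerant :: "'b set \<Rightarrow> ('b \<Rightarrow> nat) \<Rightarrow> int \<Rightarrow> nat" where
  "denumerant C m q = card {x \<in> C \<rightarrow>\<^sub>E {0<..}. int (\<Sum>c\<in>C. m c * x c) = q}"

text \<open>Stars and bars: such a function is the multiplicity function of a multiset of size \<open>n\<close> over \<open>C\<close>.\<close>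

lemma card_functions_with_sum:
  fixes C :: "'b set"
  assumes "finite C" "C \<noteq> {}"
  shows "card {b \<in> C \<rightarrow>\<^sub>E (UNIV :: nat set). sum b C = n} =
    (n + card C - 1) choose (card C - 1)"
proof -
  have "bij_betw (\<lambda>X. restrict (count X) C) {X. size X = n \<and> set_mset X \<subseteq> C}
      {b \<in> C \<rightarrow>\<^sub>E (UNIV :: nat set). sum b C = n}"
  proof (rule bij_betw_byWitness [where f' = "\<lambda>b. \<Sum>c\<in>C. replicate_mset (b c) c"])
    have cnt: "count (\<Sum>c\<in>C. replicate_mset (b c) c) d = (if d \<in> C then b d else 0)" for b d
      using assms(1) by (simp add: count_sum sum.delta)
    show "\<forall>X\<in>{X. size X = n \<and> set_mset X \<subseteq> C}.
        (\<Sum>c\<in>C. replicate_mset (restrict (count X) C c) c) = X"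
      by (auto intro!: multiset_eqI simp: cnt not_in_iff [symmetric])
    show "\<forall>b\<in>{b \<in> C \<rightarrow>\<^sub>E UNIV. sum b C = n}.
        restrict (count (\<Sum>c\<in>C. replicate_mset (b c) c)) C = b"
      by (auto simp: cnt fun_eq_iff PiE_def extensional_def)
    show "(\<lambda>X. restrict (count X) C) ` {X. size X = n \<and> set_mset X \<subseteq> C} \<subseteq>
        {b \<in> C \<rightarrow>\<^sub>E (UNIV :: nat set). sum b C = n}"
    proof clarsimp
      fix X :: "'b multiset" assume "set_mset X \<subseteq> C"
      then show "sum (count X) C = size X"
        unfolding size_multiset_overloaded_eq using assms(1)
        by (intro sum.mono_neutral_right) (auto simp: not_in_iff)
    qed
    show "(\<lambda>b. \<Sum>c\<in>C. replicate_mset (b c) c) ` {b \<in> C \<rightarrow>\<^sub>E UNIV. sum b C = n} \<subseteq>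
        {X. size X = n \<and> set_mset X \<subseteq> C}"
    proof (intro image_subsetI)
      fix b :: "'b \<Rightarrow> nat" assume b: "b \<in> {b \<in> C \<rightarrow>\<^sub>E UNIV. sum b C = n}"
      have "size (\<Sum>c\<in>C. replicate_mset (b c) c) = sum b C"
        using assms(1) by (induction C rule: finite_induct) auto
      moreover have "set_mset (\<Sum>c\<in>C. replicate_mset (b c) c) \<subseteq> C"
      proof
        fix d assume "d \<in># (\<Sum>c\<in>C. replicate_mset (b c) c)"
        then have "count (\<Sum>c\<in>C. replicate_mset (b c) c) d \<noteq> 0" by simp
        then show "d \<in> C" unfolding cnt by (simp split: if_splits)
      qed
      ultimately show "(\<Sum>c\<in>C. replicate_mset (b c) c) \<in> {X. size X = n \<and> set_mset X \<subseteq> C}"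
        using b by blast
    qed
  qed
  then have "card {b \<in> C \<rightarrow>\<^sub>E (UNIV :: nat set). sum b C = n} =
      card {X. size X = n \<and> set_mset X \<subseteq> C}"
    by (simp add: bij_betw_same_card)
  also have "\<dots> = (n + card C - 1) choose n"
    using card_multisets_of_size [of C n] assms by (simp add: multisets_of_size_def conj_commute add.commute)
  also have "\<dots> = (n + card C - 1) choose (card C - 1)"
  proof -
    obtain j where "card C = Suc j" using assms by (metis card_eq_0_iff not0_implies_Suc)
    then show ?thesis using binomial_symmetric [of n "n + j"] by simp
  qed
  finally show ?thesis .
qed

text \<open>The quasi-polynomial behind the denumerant, for a common multiple \<open>N\<close> of the weights. Writing
  \<open>x c = a c + (N / m c) * b c\<close> with \<open>1 \<le> a c \<le> N / m c\<close> makes all weights of the \<open>b c\<close> equal to \<open>N\<close>,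
  so for fixed \<open>a\<close> the number of solutions is the binomial coefficient of stars and bars.\<close>

definition denumerant_poly :: "'b set \<Rightarrow> ('b \<Rightarrow> nat) \<Rightarrow> nat \<Rightarrow> int \<Rightarrow> complex" where
  "denumerant_poly C m N q = (\<Sum>a\<in>(\<Pi>\<^sub>E c\<in>C. {1..N div m c}).
     if int N dvd q - int (\<Sum>c\<in>C. m c * a c)
     then (of_int ((q - int (\<Sum>c\<in>C. m c * a c)) div int N) + of_nat (card C - 1))
            gchoose (card C - 1)
     else 0)"

text \<open>The binomial polynomial is the right count even for some negative \<open>s\<close>, because it vanishes at the
  \<open>card C - 1\<close> integers below zero. This is why the formula for denumerants is valid for every
  \<open>q > 0\<close>, and not only for large \<open>q\<close>.\<close>

lemma card_scaled_functions_with_sum: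
  fixes C :: "'b set"
  assumes "finite C" "C \<noteq> {}" "N > 0" and s: "- int N * int (card C) < s"
  shows "of_nat (card {b \<in> C \<rightarrow>\<^sub>E (UNIV :: nat set). int N * int (sum b C) = s}) =
    (if int N dvd s then (of_int (s div int N) + of_nat (card C - 1)) gchoose (card C - 1)
     else (0 :: complex))"
proof (cases "int N dvd s")
  case False
  then have none: "{b \<in> C \<rightarrow>\<^sub>E (UNIV :: nat set). int N * int (sum b C) = s} = {}"
    by (auto simp del: of_nat_sum)
  show ?thesis unfolding none using False by simp
next
  case True
  then obtain t where t: "s = int N * t" by blast
  have k: "card C \<ge> 1" using assms by (simp add: Suc_leI card_gt_0_iff)
  have "int N * (- int (card C)) < int N * t" using s t by simp
  then have tgt: "- int (card C) < t"
    using assms(3) by (simp only: mult_less_cancel_left)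
  have set: "{b \<in> C \<rightarrow>\<^sub>E (UNIV :: nat set). int N * int (sum b C) = s} =
      {b \<in> C \<rightarrow>\<^sub>E (UNIV :: nat set). int (sum b C) = t}"
    using assms(3) t by auto
  have div: "s div int N = t" using assms(3) t by simp
  show ?thesis
  proof (cases "t \<ge> 0")
    case True
    then obtain n where n: "t = int n" using nonneg_int_cases by blast
    have "of_nat (card {b \<in> C \<rightarrow>\<^sub>E (UNIV :: nat set). sum b C = n}) =
        (of_nat ((n + (card C - 1)) choose (card C - 1)) :: complex)"
      using card_functions_with_sum [OF assms(1,2), of n] k by simp
    also have "\<dots> = (of_nat (n + (card C - 1)) gchoose (card C - 1))"
      by (rule binomial_gbinomial)
    finally show ?thesis
      unfolding set div using \<open>int N dvd s\<close> n by (simp del: of_nat_sum)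
  next
    \<comment> \<open>Here \<open>t + (card C - 1)\<close> is a natural number below \<open>card C - 1\<close>, where the binomial
       coefficient vanishes.\<close>
    case False
    define j where "j = nat (t + int (card C - 1))"
    have j: "t + int (card C - 1) = int j" "j < card C - 1"
      using False tgt k by (auto simp: j_def)
    have "(of_int t + of_nat (card C - 1) :: complex) = of_nat j"
      using j(1) by (metis of_int_add of_int_of_nat_eq)
    then have "(of_int t + of_nat (card C - 1) :: complex) gchoose (card C - 1) = 0"
      using j(2) by (metis binomial_eq_0 binomial_gbinomial of_nat_0)
    moreover have none: "{b \<in> C \<rightarrow>\<^sub>E (UNIV :: nat set). int (sum b C) = t} = {}"
      using False by (auto simp del: of_nat_sum)
    ultimately show ?thesis unfolding set div none by simp
  qed
qed

lemma denumerant_eq_denumerant_poly: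
  fixes C :: "'b set"
  assumes C: "finite C" "C \<noteq> {}" and N: "N > 0"
    and m: "\<And>c. c \<in> C \<Longrightarrow> m c > 0" "\<And>c. c \<in> C \<Longrightarrow> m c dvd N" and q: "q > 0"
  shows "of_nat (denumerant C m q) = denumerant_poly C m N q"
proof -
  define A where "A = (\<Pi>\<^sub>E c\<in>C. {1..N div m c})"
  define B where "B a = {b \<in> C \<rightarrow>\<^sub>E (UNIV :: nat set).
    int N * int (sum b C) = q - int (\<Sum>c\<in>C. m c * a c)}" for a
  define S where "S = {x \<in> C \<rightarrow>\<^sub>E {0<..}. int (\<Sum>c\<in>C. m c * x c) = q}"
  have Nm: "N div m c > 0" "m c * (N div m c) = N" if "c \<in> C" for c
    using that m N by (auto simp: div_greater_zero_iff dvd_imp_le)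
  have split: "(\<Sum>c\<in>C. m c * (a c + N div m c * b c)) = (\<Sum>c\<in>C. m c * a c) + N * sum b C"
    for a b :: "'b \<Rightarrow> nat"
  proof -
    have "m c * (a c + N div m c * b c) = m c * a c + N * b c" if "c \<in> C" for c
      using Nm(2) [OF that] by (metis distrib_left mult.assoc)
    then have "(\<Sum>c\<in>C. m c * (a c + N div m c * b c)) = (\<Sum>c\<in>C. m c * a c + N * b c)"
      by (rule sum.cong [OF refl])
    then show ?thesis by (simp add: sum.distrib sum_distrib_left)
  qed
  define f where "f p = (\<lambda>c\<in>C. fst p c + N div m c * snd p c)" for p
  define g where "g x = (\<lambda>c\<in>C. (x c - 1) mod (N div m c) + 1, \<lambda>c\<in>C. (x c - 1) div (N div m c))"
    for x
  have rep: "(x - 1) mod n + 1 + n * ((x - 1) div n) = x" if "x > 0" for x n :: nat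
    using that mult_div_mod_eq [of n "x - 1"] by linarith
  have "bij_betw f (Sigma A B) S"
  proof (rule bij_betw_byWitness [where f' = g])
    show "\<forall>p\<in>Sigma A B. g (f p) = p"
    proof (intro ballI)
      fix p assume "p \<in> Sigma A B"
      then obtain a b where p: "p = (a, b)" and ab: "a \<in> A" "b \<in> B a" by (elim SigmaE)
      have "(a c + N div m c * b c - 1) mod (N div m c) + 1 = a c \<and>
          (a c + N div m c * b c - 1) div (N div m c) = b c" if "c \<in> C" for c
      proof -
        have "a c \<ge> 1" "a c \<le> N div m c" using ab(1) that unfolding A_def by (auto dest: PiE_mem)
        then obtain d where "a c = Suc d" "d < N div m c"
          by (metis Suc_le_D Suc_le_lessD One_nat_def)
        then show ?thesis using Nm(1) [OF that] by simp
      qed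
      moreover have "a c = undefined" "b c = undefined" if "c \<notin> C" for c
        using ab that unfolding A_def B_def by (auto simp: PiE_def extensional_def)
      ultimately show "g (f p) = p"
        unfolding p g_def f_def by (auto simp: fun_eq_iff)
    qed
    show "\<forall>x\<in>S. f (g x) = x"
    proof
      fix x assume x: "x \<in> S"
      show "f (g x) = x"
      proof
        fix c
        show "f (g x) c = x c"
        proof (cases "c \<in> C")
          case True
          then have "x c > 0" using x unfolding S_def by (auto dest: PiE_mem)
          then show ?thesis
            using True unfolding f_def g_def by (simp only: fst_conv snd_conv restrict_apply' rep)
        next
          case False
          then have "x c = undefined"
            using x unfolding S_def by (auto simp: PiE_def extensional_def)
          then show ?thesis using False by (simp add: f_def)
        qed
      qed
    qed
    show "f ` Sigma A B \<subseteq> S"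
    proof (intro image_subsetI)
      fix p assume "p \<in> Sigma A B"
      then obtain a b where p: "p = (a, b)" and ab: "a \<in> A" "b \<in> B a" by (elim SigmaE)
      have "int (\<Sum>c\<in>C. m c * (a c + N div m c * b c)) = q"
        unfolding split using ab(2) by (simp add: B_def)
      moreover have "a c > 0" if "c \<in> C" for c
        using ab(1) that unfolding A_def by (force dest: PiE_mem)
      ultimately show "f p \<in> S"
        unfolding S_def p f_def by (auto simp: PiE_iff)
    qed
    show "g ` S \<subseteq> Sigma A B"
    proof (intro image_subsetI)
      fix x assume x: "x \<in> S"
      have "fst (g x) \<in> A"
        using Nm(1) unfolding A_def g_def by (auto simp: PiE_iff Suc_le_eq)
      moreover have eq: "(\<Sum>c\<in>C. m c * fst (g x) c) + N * sum (snd (g x)) C = (\<Sum>c\<in>C. m c * x c)"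
      proof -
        have "(\<Sum>c\<in>C. m c * fst (g x) c) + N * sum (snd (g x)) C =
            (\<Sum>c\<in>C. m c * (fst (g x) c + N div m c * snd (g x) c))"
          by (rule split [symmetric])
        also have "\<dots> = (\<Sum>c\<in>C. m c * x c)"
        proof (rule sum.cong [OF refl])
          fix c assume c: "c \<in> C"
          then have "x c > 0" using x unfolding S_def by (auto dest: PiE_mem)
          then show "m c * (fst (g x) c + N div m c * snd (g x) c) = m c * x c"
            using c unfolding g_def by (simp only: fst_conv snd_conv restrict_apply' rep)
        qed
        finally show ?thesis .
      qed
      have "int (\<Sum>c\<in>C. m c * fst (g x) c) + int N * int (sum (snd (g x)) C) = q"
        using arg_cong [OF eq, of int] x by (simp add: S_def)
      then have "snd (g x) \<in> B (fst (g x))"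
        unfolding B_def by (auto simp: g_def)
      ultimately show "g x \<in> Sigma A B"
        using mem_Sigma_iff [of "fst (g x)" "snd (g x)" A B] by simp
    qed
  qed
  then have "denumerant C m q = card (Sigma A B)"
    unfolding denumerant_def S_def [symmetric] by (simp add: bij_betw_same_card)
  also have "card (Sigma A B) = (\<Sum>a\<in>A. card (B a))"
  proof (rule card_SigmaI)
    show "finite A" unfolding A_def using C(1) by (intro finite_PiE) auto
    show "\<forall>a\<in>A. finite (B a)"
    proof
      fix a
      have "B a \<subseteq> C \<rightarrow>\<^sub>E {..nat q}"
      proof
        fix b assume b: "b \<in> B a"
        have "b c \<le> nat q" if "c \<in> C" for c
        proof -
          have "b c \<le> sum b C" using C(1) that by (simp add: member_le_sum)
          then have "int (b c) \<le> int (sum b C)" by (simp only: of_nat_le_iff)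
          also have "\<dots> \<le> int N * int (sum b C)"
            using N by (simp add: mult_le_cancel_right1 del: of_nat_sum)
          also have "\<dots> \<le> q" using b by (simp add: B_def del: of_nat_sum)
          finally show ?thesis by simp
        qed
        then show "b \<in> C \<rightarrow>\<^sub>E {..nat q}" using b by (auto simp: B_def)
      qed
      then show "finite (B a)" using C(1) by (meson finite_PiE finite_atMost finite_subset)
    qed
  qed
  also have "of_nat (\<Sum>a\<in>A. card (B a)) = denumerant_poly C m N q"
  proof -
    have "of_nat (card (B a)) =
      (if int N dvd q - int (\<Sum>c\<in>C. m c * a c)
       then (of_int ((q - int (\<Sum>c\<in>C. m c * a c)) div int N) + of_nat (card C - 1))
            gchoose (card C - 1)
       else (0 :: complex))" if a: "a \<in> A" for a
    proof -
      have "(\<Sum>c\<in>C. m c * a c) \<le> (\<Sum>c\<in>C. N)"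
      proof (rule sum_mono)
        fix c assume c: "c \<in> C"
        then have "a c \<le> N div m c" using a unfolding A_def by (auto dest: PiE_mem)
        then show "m c * a c \<le> N" using Nm(2) [OF c] by (metis mult_le_mono2)
      qed
      then have "(\<Sum>c\<in>C. m c * a c) \<le> card C * N" by simp
      then have "int (\<Sum>c\<in>C. m c * a c) \<le> int (card C) * int N"
        by (simp only: of_nat_le_iff flip: of_nat_mult)
      then have "int (\<Sum>c\<in>C. m c * a c) \<le> int N * int (card C)"
        by (simp only: mult.commute [of "int N"])
      then have "- int N * int (card C) < q - int (\<Sum>c\<in>C. m c * a c)"
        using q by simp
      from card_scaled_functions_with_sum [OF C N this] show ?thesis
        unfolding B_def .
    qed
    then show ?thesis unfolding denumerant_poly_def A_def [symmetric] by simp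
  qed
  finally show ?thesis .
qed

text \<open>The substitution \<open>a c \<mapsto> N / m c + 1 - a c\<close> permutes the summands. Combined with
  \<open>q \<mapsto> sum m C - q\<close> it sends the quotient \<open>t\<close> in the binomial coefficient to \<open>- t - card C\<close>, and
  there the upper negation rule for binomial coefficients produces the sign.\<close>

lemma denumerant_poly_reciprocity:
  fixes C :: "'b set"
  assumes C: "finite C" "C \<noteq> {}" and N: "N > 0"
    and m: "\<And>c. c \<in> C \<Longrightarrow> m c > 0" "\<And>c. c \<in> C \<Longrightarrow> m c dvd N"
  shows "denumerant_poly C m N (int (sum m C) - q) =
    (-1) ^ (card C - 1) * denumerant_poly C m N q"
proof -
  define A where "A = (\<Pi>\<^sub>E c\<in>C. {1..N div m c})"
  define r where "r a = (\<lambda>c\<in>C. N div m c + 1 - a c)" for a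
  define T where "T q a = (if int N dvd q - int (\<Sum>c\<in>C. m c * a c)
     then (of_int ((q - int (\<Sum>c\<in>C. m c * a c)) div int N) + of_nat (card C - 1))
            gchoose (card C - 1)
     else (0 :: complex))" for q a
  have k: "card C \<ge> 1" using C by (simp add: Suc_leI card_gt_0_iff)
  have Nm: "m c * (N div m c) = N" if "c \<in> C" for c
    using that m by auto
  have bound: "1 \<le> a c" "a c \<le> N div m c" if "a \<in> A" "c \<in> C" for a c
    using that unfolding A_def by (auto dest: PiE_mem)
  have rA: "r a \<in> A" if "a \<in> A" for a
    using bound [OF that] unfolding A_def r_def by (fastforce simp: PiE_iff)
  have rr: "r (r a) = a" if "a \<in> A" for a
    using bound [OF that] that unfolding r_def A_def by (fastforce simp: fun_eq_iff PiE_def extensional_def)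
  have sum_r: "int (\<Sum>c\<in>C. m c * r a c) =
      int N * int (card C) + int (sum m C) - int (\<Sum>c\<in>C. m c * a c)" if a: "a \<in> A" for a
  proof -
    have "m c * r a c + m c * a c = N + m c" if c: "c \<in> C" for c
    proof -
      have "r a c + a c = N div m c + 1" using bound [OF a c] c by (simp add: r_def)
      then have "m c * (r a c + a c) = m c * (N div m c + 1)" by simp
      then show ?thesis using Nm [OF c] by (simp add: distrib_left)
    qed
    then have "(\<Sum>c\<in>C. m c * r a c + m c * a c) = (\<Sum>c\<in>C. N + m c)"
      by (rule sum.cong [OF refl])
    then have "(\<Sum>c\<in>C. m c * r a c) + (\<Sum>c\<in>C. m c * a c) = N * card C + sum m C"
      by (simp add: sum.distrib mult.commute)
    then have "int ((\<Sum>c\<in>C. m c * r a c) + (\<Sum>c\<in>C. m c * a c)) = int (N * card C + sum m C)"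
      by (rule arg_cong)
    then show ?thesis by (simp only: of_nat_add of_nat_mult)
  qed
  have "T (int (sum m C) - q) (r a) = (-1) ^ (card C - 1) * T q a" if a: "a \<in> A" for a
  proof -
    define s where "s = q - int (\<Sum>c\<in>C. m c * a c)"
    have e: "int (sum m C) - q - int (\<Sum>c\<in>C. m c * r a c) = - s - int N * int (card C)"
      unfolding sum_r [OF a] s_def by linarith
    have dv: "int N dvd - s - int N * int (card C) \<longleftrightarrow> int N dvd s"
      by (simp add: dvd_diff_left_iff)
    show ?thesis
    proof (cases "int N dvd s")
      case True
      then obtain t where t: "s = int N * t" by blast
      have "- s - int N * int (card C) = int N * (- t - int (card C))"
        using t by (simp add: algebra_simps)
      then have d: "(- s - int N * int (card C)) div int N = - t - int (card C)"
        using N by simp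
      have "(of_int (- t - int (card C)) + of_nat (card C - 1) :: complex) = - of_int t - 1"
        using k by (simp add: of_nat_diff)
      moreover have "(- of_int t - 1 :: complex) gchoose (card C - 1) =
          (-1) ^ (card C - 1) * ((of_int t + of_nat (card C - 1)) gchoose (card C - 1))"
        by (subst gbinomial_negated_upper) (simp add: algebra_simps)
      ultimately have "(of_int (- t - int (card C)) + of_nat (card C - 1) :: complex)
          gchoose (card C - 1) =
          (-1) ^ (card C - 1) * ((of_int t + of_nat (card C - 1)) gchoose (card C - 1))"
        by (simp only:)
      moreover have "s div int N = t" using t N by simp
      ultimately show ?thesis
        unfolding T_def e s_def [symmetric] dv d using True by (simp only: if_True)
    next
      case False
      then show ?thesis unfolding T_def e s_def [symmetric] dv by simp
    qed
  qed
  then have "(\<Sum>a\<in>A. T (int (sum m C) - q) (r a)) = (-1) ^ (card C - 1) * (\<Sum>a\<in>A. T q a)"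
    by (simp add: sum_distrib_left)
  moreover have "(\<Sum>a\<in>A. T (int (sum m C) - q) (r a)) = (\<Sum>a\<in>A. T (int (sum m C) - q) a)"
    by (rule sum.reindex_bij_witness [of A r r]) (auto simp: rA rr)
  ultimately show ?thesis
    unfolding denumerant_poly_def A_def [symmetric] T_def by simp
qed

theorem denumerant_reciprocity:
  fixes C :: "'b set"
  assumes C: "finite C" "C \<noteq> {}" and m: "\<And>c. c \<in> C \<Longrightarrow> m c > 0"
  shows "\<exists>g. quasi_polynomial g \<and> (\<forall>q>0. g q = of_nat (denumerant C m q)) \<and>
    (\<forall>q. g (int (sum m C) - q) = (-1) ^ (card C - 1) * g q)"
proof (intro exI conjI allI impI)
  let ?N = "\<Prod>c\<in>C. m c"
  have N: "?N > 0" using m by (simp add: prod_pos)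
  have dvd: "m c dvd ?N" if "c \<in> C" for c
    using C(1) that by (simp add: dvd_prodI)
  show "quasi_polynomial (denumerant_poly C m ?N)"
    unfolding denumerant_poly_def using N
    by (intro quasi_polynomial_sum quasi_polynomial_gbinomial) (simp del: of_nat_prod)
  show "denumerant_poly C m ?N q = of_nat (denumerant C m q)" if "q > 0" for q
    using denumerant_eq_denumerant_poly [OF C N m dvd that] by simp
  show "denumerant_poly C m ?N (int (sum m C) - q) =
      (-1) ^ (card C - 1) * denumerant_poly C m ?N q" for q
    by (rule denumerant_poly_reciprocity [OF C N m dvd])
qed

section \<open>Roots and the Weyl group\<close>

lemma root_system_uminus:
  assumes "root_system \<Phi>" "\<alpha> \<in> \<Phi>"
  shows "- \<alpha> \<in> \<Phi>"
proof -
  have "refl_along \<alpha> \<alpha> = - \<alpha>"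
    using assms by (auto simp: refl_along_def root_system_def scaleR_2)
  then show ?thesis
    using assms unfolding root_system_def by metis
qed

text \<open>The two Cartan integers of the pair are positive. If one of them is \<open>1\<close>, a reflection yields the
  difference up to sign; if both are at least \<open>2\<close>, then \<open>(\<alpha> - \<beta>) \<bullet> (\<alpha> - \<beta>) \<le> 0\<close>.\<close>

lemma root_system_diff:
  assumes R: "root_system \<Phi>" and ab: "\<alpha> \<in> \<Phi>" "\<beta> \<in> \<Phi>" "\<alpha> \<bullet> \<beta> > 0" "\<alpha> \<noteq> \<beta>"
  shows "\<alpha> - \<beta> \<in> \<Phi>"
proof -
  have nz: "\<alpha> \<noteq> 0" "\<beta> \<noteq> 0" using R ab unfolding root_system_def by auto
  then have pos: "\<alpha> \<bullet> \<alpha> > 0" "\<beta> \<bullet> \<beta> > 0" by auto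
  obtain p where p: "2 * (\<alpha> \<bullet> \<beta>) / (\<beta> \<bullet> \<beta>) = of_int p"
    using R ab unfolding root_system_def by (metis Ints_cases)
  obtain r where r: "2 * (\<beta> \<bullet> \<alpha>) / (\<alpha> \<bullet> \<alpha>) = of_int r"
    using R ab unfolding root_system_def by (metis Ints_cases)
  have "0 < (of_int p :: real)" "0 < (of_int r :: real)"
    unfolding p [symmetric] r [symmetric] using pos ab by (simp_all add: inner_commute)
  then have pr: "p \<ge> 1" "r \<ge> 1" by simp_all
  have refl: "refl_along \<beta> \<alpha> = \<alpha> - of_int p *\<^sub>R \<beta>" "refl_along \<alpha> \<beta> = \<beta> - of_int r *\<^sub>R \<alpha>"
    by (simp_all add: refl_along_def p r)
  have mem: "refl_along \<beta> \<alpha> \<in> \<Phi>" "refl_along \<alpha> \<beta> \<in> \<Phi>"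
    using R ab unfolding root_system_def by auto
  consider "p = 1" | "r = 1" | "p \<ge> 2" "r \<ge> 2" using pr by linarith
  then show ?thesis
  proof cases
    case 1
    then show ?thesis using mem refl by simp
  next
    case 2
    then show ?thesis using root_system_uminus [OF R mem(2)] refl by simp
  next
    case 3
    then have "2 * (\<alpha> \<bullet> \<beta>) \<ge> 2 * (\<beta> \<bullet> \<beta>)" "2 * (\<beta> \<bullet> \<alpha>) \<ge> 2 * (\<alpha> \<bullet> \<alpha>)"
      using p r pos by (simp_all add: field_simps)
    then have "(\<alpha> - \<beta>) \<bullet> (\<alpha> - \<beta>) \<le> 0"
      by (simp add: inner_diff_left inner_diff_right inner_commute)
    then have "\<alpha> = \<beta>"
      by (metis eq_iff_diff_eq_0 inner_eq_zero_iff inner_ge_zero order_antisym)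
    with ab show ?thesis by simp
  qed
qed

lemma weyl_group_compose:
  assumes "u \<in> weyl_group \<Phi>" "w \<in> weyl_group \<Phi>"
  shows "u \<circ> w \<in> weyl_group \<Phi>"
  using assms
  by (induction rule: weyl_group.induct) (auto simp: comp_assoc intro: weyl_group.intros)

lemma weyl_group_refl_along: "\<alpha> \<in> \<Phi> \<Longrightarrow> refl_along \<alpha> \<in> weyl_group \<Phi>"
  using weyl_group.weyl_refl [OF _ weyl_group.weyl_id] by auto

lemma refl_along_bij: "bij (refl_along \<alpha>)" and refl_along_inv: "inv (refl_along \<alpha>) = refl_along \<alpha>"
proof -
  have "refl_along \<alpha> \<circ> refl_along \<alpha> = id"
    by (auto simp: refl_along_involution)
  then show "bij (refl_along \<alpha>)" "inv (refl_along \<alpha>) = refl_along \<alpha>"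
    by (auto intro: o_bij inv_unique_comp)
qed

lemma weyl_group_bij: "u \<in> weyl_group \<Phi> \<Longrightarrow> bij u"
  by (induction rule: weyl_group.induct) (rule bij_id, rule bij_comp [OF _ refl_along_bij])

lemma weyl_group_inv:
  assumes "u \<in> weyl_group \<Phi>"
  shows "inv u \<in> weyl_group \<Phi>"
  using assms
proof (induction rule: weyl_group.induct)
  case (weyl_refl \<alpha> w)
  then have "inv (refl_along \<alpha> \<circ> w) = inv w \<circ> refl_along \<alpha>"
    by (simp add: o_inv_distrib refl_along_bij refl_along_inv weyl_group_bij)
  then show ?case
    using weyl_group_compose [OF weyl_refl.IH weyl_group_refl_along [OF weyl_refl.hyps(1)]]
    by (simp only:)
qed (simp only: inv_id weyl_group.weyl_id)

lemma weyl_group_inner: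
  assumes "u \<in> weyl_group \<Phi>"
  shows "u x \<bullet> u y = x \<bullet> y"
  using assms
  by (induction arbitrary: x y rule: weyl_group.induct)
    (simp_all add: refl_along_adjoint refl_along_involution)

lemma weyl_group_inv_cancel:
  assumes "u \<in> weyl_group \<Phi>"
  shows "u (inv u x) = x" "inv u (u x) = x"
  using weyl_group_bij [OF assms] by (simp_all add: bij_is_surj surj_f_inv_f bij_is_inj)

lemma weyl_group_adjoint:
  assumes "u \<in> weyl_group \<Phi>"
  shows "u x \<bullet> y = x \<bullet> inv u y" "inv u x \<bullet> y = x \<bullet> u y"
  using weyl_group_inner [OF assms] weyl_group_inv_cancel [OF assms] by metis+

lemma weyl_group_root:
  assumes "root_system \<Phi>" "u \<in> weyl_group \<Phi>" "\<alpha> \<in> \<Phi>"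
  shows "u \<alpha> \<in> \<Phi>"
  using assms(2) by (induction rule: weyl_group.induct)
    (use assms in \<open>auto simp: root_system_def\<close>)

lemma finite_weyl_group:
  assumes "root_system \<Phi>"
  shows "finite (weyl_group \<Phi>)"
proof -
  have "inj_on (\<lambda>w. restrict w \<Phi>) (weyl_group \<Phi>)"
  proof (rule inj_onI)
    fix u w assume uw: "u \<in> weyl_group \<Phi>" "w \<in> weyl_group \<Phi>" "restrict u \<Phi> = restrict w \<Phi>"
    have "u x = w x" for x
    proof (rule linear_eq_on [of u w x \<Phi>])
      show "x \<in> span \<Phi>" using assms by (simp add: root_system_def)
      show "u y = w y" if "y \<in> \<Phi>" for y using that uw(3) by (metis restrict_apply')
    qed (use uw weyl_group_linear in auto)
    then show "u = w" by blast
  qed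
  moreover have "(\<lambda>w. restrict w \<Phi>) ` weyl_group \<Phi> \<subseteq> \<Phi> \<rightarrow>\<^sub>E \<Phi>"
    using weyl_group_root [OF assms] by auto
  moreover have "finite (\<Phi> \<rightarrow>\<^sub>E \<Phi>)"
    using assms by (intro finite_PiE) (auto simp: root_system_def)
  ultimately show ?thesis by (metis finite_imageD finite_subset)
qed

section \<open>Simple roots, the highest root and the extended base\<close>

locale based_root_system =
  fixes \<Phi> \<Delta> :: "'a::euclidean_space set" and \<theta> :: 'a
  assumes root_system: "root_system \<Phi>"
    and simple: "simple_roots \<Phi> \<Delta>"
    and highest: "highest_root \<Phi> \<Delta> \<theta>"
begin

abbreviation W :: "('a \<Rightarrow> 'a) set" where "W \<equiv> weyl_group \<Phi>"

abbreviation Z :: "'a set" where "Z \<equiv> coweight_lattice \<Phi>"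

lemma finite_base: "finite \<Delta>" and base_root: "\<alpha> \<in> \<Delta> \<Longrightarrow> \<alpha> \<in> \<Phi>"
  using simple by (auto simp: simple_roots_def intro: independent_imp_finite)

lemma base_nonempty: "\<Delta> \<noteq> {}"
proof
  assume "\<Delta> = {}"
  then have "(UNIV :: 'a set) = {0}" using simple by (simp add: simple_roots_def)
  then show False using nonempty_Basis nonzero_Basis by blast
qed

lemma inner_base_surj: "\<exists>y. \<forall>\<alpha>\<in>\<Delta>. \<alpha> \<bullet> y = f \<alpha>" for f :: "'a \<Rightarrow> real"
proof -
  obtain g :: "'a \<Rightarrow> real" where g: "linear g" "\<And>x. x \<in> \<Delta> \<Longrightarrow> g x = f x"
    using simple linear_independent_extend [of \<Delta> f] by (auto simp: simple_roots_def)
  have "x \<bullet> adjoint g 1 = g x" for x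
    using adjoint_works [OF g(1), of x 1] by simp
  with g show ?thesis by metis
qed

lemma inner_base_inj:
  assumes "\<And>\<alpha>. \<alpha> \<in> \<Delta> \<Longrightarrow> \<alpha> \<bullet> x = \<alpha> \<bullet> y"
  shows "x = y"
proof -
  have "z \<bullet> x = z \<bullet> y" for z
    by (rule linear_eq_on [where f = "\<lambda>z. z \<bullet> x" and g = "\<lambda>z. z \<bullet> y" and B = \<Delta>])
      (use simple assms in \<open>auto simp: simple_roots_def bounded_linear_inner_left bounded_linear.linear\<close>)
  then show ?thesis by (metis inner_commute vector_eq_ldot)
qed

definition coweight :: "'a \<Rightarrow> 'a" where
  "coweight \<alpha> = (SOME y. \<forall>\<beta>\<in>\<Delta>. \<beta> \<bullet> y = (if \<beta> = \<alpha> then 1 else 0))"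

definition rho :: 'a where
  "rho = (\<Sum>\<alpha>\<in>\<Delta>. coweight \<alpha>)"

lemma inner_coweight: "\<beta> \<in> \<Delta> \<Longrightarrow> \<beta> \<bullet> coweight \<alpha> = (if \<beta> = \<alpha> then 1 else 0)"
  unfolding coweight_def
  using someI_ex [OF inner_base_surj [of "\<lambda>\<beta>. if \<beta> = \<alpha> then 1 else 0"]] by blast

lemma coefficient:
  assumes "\<alpha> \<in> \<Delta>"
  shows "(\<Sum>\<beta>\<in>\<Delta>. f \<beta> *\<^sub>R \<beta>) \<bullet> coweight \<alpha> = f \<alpha>"
proof -
  have "(\<Sum>\<beta>\<in>\<Delta>. f \<beta> *\<^sub>R \<beta>) \<bullet> coweight \<alpha> = (\<Sum>\<beta>\<in>\<Delta>. if \<beta> = \<alpha> then f \<beta> else 0)"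
    unfolding inner_sum_left by (rule sum.cong) (auto simp: inner_coweight)
  then show ?thesis using assms finite_base by simp
qed

lemma expansion: "v = (\<Sum>\<alpha>\<in>\<Delta>. (v \<bullet> coweight \<alpha>) *\<^sub>R \<alpha>)"
proof -
  have "v \<in> span \<Delta>" using simple by (simp add: simple_roots_def)
  then obtain f where "v = (\<Sum>\<alpha>\<in>\<Delta>. f \<alpha> *\<^sub>R \<alpha>)"
    using finite_base by (auto simp: span_finite)
  then show ?thesis by (simp add: coefficient cong: sum.cong)
qed

lemma inner_expansion: "v \<bullet> x = (\<Sum>\<alpha>\<in>\<Delta>. (v \<bullet> coweight \<alpha>) * (\<alpha> \<bullet> x))"
  by (subst expansion [of v]) (simp add: inner_sum_left)

lemma root_coefficients:
  assumes "\<beta> \<in> \<Phi>"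
  obtains c :: "'a \<Rightarrow> nat" where "\<And>\<alpha>. \<alpha> \<in> \<Delta> \<Longrightarrow> \<beta> \<bullet> coweight \<alpha> = real (c \<alpha>)"
  | c :: "'a \<Rightarrow> nat" where "\<And>\<alpha>. \<alpha> \<in> \<Delta> \<Longrightarrow> \<beta> \<bullet> coweight \<alpha> = - real (c \<alpha>)"
proof -
  obtain c :: "'a \<Rightarrow> nat" where
    "\<beta> = (\<Sum>\<alpha>\<in>\<Delta>. real (c \<alpha>) *\<^sub>R \<alpha>) \<or> \<beta> = - (\<Sum>\<alpha>\<in>\<Delta>. real (c \<alpha>) *\<^sub>R \<alpha>)"
    using simple assms unfolding simple_roots_def by meson
  then have "(\<forall>\<alpha>\<in>\<Delta>. \<beta> \<bullet> coweight \<alpha> = real (c \<alpha>)) \<or> (\<forall>\<alpha>\<in>\<Delta>. \<beta> \<bullet> coweight \<alpha> = - real (c \<alpha>))"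
    using coefficient by fastforce
  then show thesis using that by blast
qed

lemma root_coefficient_Ints: "\<beta> \<in> \<Phi> \<Longrightarrow> \<alpha> \<in> \<Delta> \<Longrightarrow> \<beta> \<bullet> coweight \<alpha> \<in> \<int>"
  by (erule root_coefficients) auto

lemma inner_rho_base: "\<alpha> \<in> \<Delta> \<Longrightarrow> \<alpha> \<bullet> rho = 1"
  using finite_base by (simp add: rho_def inner_sum_right inner_coweight)

lemma inner_rho: "v \<bullet> rho = (\<Sum>\<alpha>\<in>\<Delta>. v \<bullet> coweight \<alpha>)"
  by (simp add: rho_def inner_sum_right)

lemma root_nonzero_coefficient:
  assumes "\<beta> \<in> \<Phi>"
  obtains \<alpha> where "\<alpha> \<in> \<Delta>" "\<beta> \<bullet> coweight \<alpha> \<noteq> 0"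
proof -
  have "\<beta> \<noteq> 0" using assms root_system by (auto simp: root_system_def)
  have "\<exists>\<alpha>\<in>\<Delta>. \<beta> \<bullet> coweight \<alpha> \<noteq> 0"
  proof (rule ccontr)
    assume "\<not> ?thesis"
    then have "\<beta> = 0" by (subst expansion [of \<beta>]) simp
    with \<open>\<beta> \<noteq> 0\<close> show False ..
  qed
  then show thesis using that by blast
qed

lemma root_height_cases:
  assumes "\<beta> \<in> \<Phi>"
  obtains "\<beta> \<bullet> rho \<ge> 1" "\<And>\<alpha>. \<alpha> \<in> \<Delta> \<Longrightarrow> \<beta> \<bullet> coweight \<alpha> \<ge> 0"
  | "\<beta> \<bullet> rho \<le> - 1" "\<And>\<alpha>. \<alpha> \<in> \<Delta> \<Longrightarrow> \<beta> \<bullet> coweight \<alpha> \<le> 0"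
proof -
  obtain \<alpha>0 where a0: "\<alpha>0 \<in> \<Delta>" "\<beta> \<bullet> coweight \<alpha>0 \<noteq> 0"
    using root_nonzero_coefficient [OF assms] .
  show thesis
  proof (rule root_coefficients [OF assms])
    fix c :: "'a \<Rightarrow> nat" assume c: "\<And>\<alpha>. \<alpha> \<in> \<Delta> \<Longrightarrow> \<beta> \<bullet> coweight \<alpha> = real (c \<alpha>)"
    have "1 \<le> real (c \<alpha>0)" using a0 c by simp
    also have "\<dots> \<le> (\<Sum>\<alpha>\<in>\<Delta>. real (c \<alpha>))"
      using a0 finite_base by (intro member_le_sum) auto
    also have "\<dots> = \<beta> \<bullet> rho" using c by (simp add: inner_rho)
    finally show thesis using that(1) c by simp
  next
    fix c :: "'a \<Rightarrow> nat" assume c: "\<And>\<alpha>. \<alpha> \<in> \<Delta> \<Longrightarrow> \<beta> \<bullet> coweight \<alpha> = - real (c \<alpha>)"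
    have "1 \<le> real (c \<alpha>0)" using a0 c by simp
    also have "\<dots> \<le> (\<Sum>\<alpha>\<in>\<Delta>. real (c \<alpha>))"
      using a0 finite_base by (intro member_le_sum) auto
    also have "\<dots> = - (\<beta> \<bullet> rho)" using c by (simp add: inner_rho sum_negf)
    finally show thesis using that(2) c by simp
  qed
qed

lemma nonneg_height_root:
  assumes "\<beta> \<in> \<Phi>" "\<beta> \<bullet> rho \<ge> 0"
  shows "\<beta> \<bullet> rho \<ge> 1" "\<And>\<alpha>. \<alpha> \<in> \<Delta> \<Longrightarrow> \<beta> \<bullet> coweight \<alpha> \<ge> 0"
proof -
  have "\<beta> \<bullet> rho \<ge> 1 \<and> (\<forall>\<alpha>\<in>\<Delta>. \<beta> \<bullet> coweight \<alpha> \<ge> 0)"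
    by (rule root_height_cases [OF assms(1)]) (use assms(2) in auto)
  then show "\<beta> \<bullet> rho \<ge> 1" "\<And>\<alpha>. \<alpha> \<in> \<Delta> \<Longrightarrow> \<beta> \<bullet> coweight \<alpha> \<ge> 0" by auto
qed

lemma highest_root: "\<theta> \<in> \<Phi>"
  using highest by (simp add: highest_root_def)

lemma coefficient_le_highest:
  assumes "\<beta> \<in> \<Phi>" "\<alpha> \<in> \<Delta>"
  shows "\<beta> \<bullet> coweight \<alpha> \<le> \<theta> \<bullet> coweight \<alpha>"
proof -
  obtain c :: "'a \<Rightarrow> nat" where "\<theta> - \<beta> = (\<Sum>\<alpha>\<in>\<Delta>. real (c \<alpha>) *\<^sub>R \<alpha>)"
    using highest assms by (auto simp: highest_root_def)
  then have "(\<theta> - \<beta>) \<bullet> coweight \<alpha> = real (c \<alpha>)"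
    using assms by (simp add: coefficient)
  then show ?thesis by (simp add: inner_diff_left)
qed

lemma highest_coefficient_ge_1: "\<alpha> \<in> \<Delta> \<Longrightarrow> \<theta> \<bullet> coweight \<alpha> \<ge> 1"
  using coefficient_le_highest [OF base_root, of \<alpha> \<alpha>] by (simp add: inner_coweight)

lemma height_le_highest: "\<beta> \<in> \<Phi> \<Longrightarrow> \<beta> \<bullet> rho \<le> \<theta> \<bullet> rho"
  unfolding inner_rho by (intro sum_mono coefficient_le_highest)

lemma height_highest: "\<theta> \<bullet> rho \<ge> 1"
  using height_le_highest base_nonempty base_root inner_rho_base by fastforce

definition extended_base :: "'a set" where
  "extended_base = insert (- \<theta>) \<Delta>"

lemma highest_not_simple: "- \<theta> \<notin> \<Delta>"
  using height_highest inner_rho_base [of "- \<theta>"] by auto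

lemma extended_base_root: "a \<in> extended_base \<Longrightarrow> a \<in> \<Phi>"
  using base_root root_system_uminus [OF root_system highest_root] by (auto simp: extended_base_def)

lemma finite_extended_base: "finite extended_base"
  by (simp add: extended_base_def finite_base)

text \<open>If the roots are read as affine functions of level \<open>q\<close>, then \<open>\<beta> + q * shift \<beta>\<close> is the smallest
  one with gradient \<open>\<beta>\<close> that is positive on the alcove.\<close>

definition shift :: "'a \<Rightarrow> nat" where
  "shift \<beta> = (if \<beta> \<bullet> rho < 0 then 1 else 0)"

text \<open>The root \<open>a\<close> is called decomposable if the affine root \<open>a + q * shift a\<close> is the sum of two affine
  roots of the same kind. On the affine level this singles out the walls of the alcove, as
  \<open>indecomposable_iff\<close> confirms.\<close>

definition indecomposable :: "'a \<Rightarrow> bool" where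
  "indecomposable a \<longleftrightarrow> (\<forall>\<beta>\<in>\<Phi>. \<forall>\<gamma>\<in>\<Phi>. a = \<beta> + \<gamma> \<longrightarrow> shift \<beta> + shift \<gamma> \<noteq> shift a)"

lemma shift_base: "\<alpha> \<in> \<Delta> \<Longrightarrow> shift \<alpha> = 0" and shift_highest: "shift (- \<theta>) = 1"
  using inner_rho_base height_highest by (auto simp: shift_def)

lemma indecomposable_simple:
  assumes "\<alpha> \<in> \<Delta>"
  shows "indecomposable \<alpha>"
  unfolding indecomposable_def
proof (intro ballI impI notI)
  fix \<beta> \<gamma> assume bc: "\<beta> \<in> \<Phi>" "\<gamma> \<in> \<Phi>" "\<alpha> = \<beta> + \<gamma>" "shift \<beta> + shift \<gamma> = shift \<alpha>"
  then have "\<beta> \<bullet> rho \<ge> 0" "\<gamma> \<bullet> rho \<ge> 0"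
    using shift_base [OF assms] by (auto simp: shift_def split: if_splits)
  then have "\<beta> \<bullet> rho \<ge> 1" "\<gamma> \<bullet> rho \<ge> 1"
    using nonneg_height_root(1) bc by auto
  then show False
    using inner_rho_base [OF assms] bc(3) by (simp add: inner_add_left)
qed

lemma indecomposable_minus_highest: "indecomposable (- \<theta>)"
  unfolding indecomposable_def
proof (intro ballI impI notI)
  fix \<beta> \<gamma> assume bc: "\<beta> \<in> \<Phi>" "\<gamma> \<in> \<Phi>" "- \<theta> = \<beta> + \<gamma>" "shift \<beta> + shift \<gamma> = shift (- \<theta>)"
  have *: "False" if "\<beta> \<in> \<Phi>" "\<gamma> \<in> \<Phi>" "- \<theta> = \<beta> + \<gamma>" "\<beta> \<bullet> rho < 0" "\<not> \<gamma> \<bullet> rho < 0" for \<beta> \<gamma>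
  proof -
    have "\<gamma> \<bullet> rho \<ge> 1" using that nonneg_height_root(1) [OF that(2)] by simp
    moreover have "\<theta> = - (\<beta> + \<gamma>)" using that(3) by (metis minus_minus)
    then have "- \<beta> = \<theta> + \<gamma>" by simp
    then have "(\<theta> + \<gamma>) \<bullet> rho \<le> \<theta> \<bullet> rho"
      using height_le_highest [OF root_system_uminus [OF root_system that(1)]] by simp
    ultimately show False by (simp add: inner_add_left)
  qed
  have "shift \<beta> + shift \<gamma> = 1" using bc(4) shift_highest by simp
  then consider "\<beta> \<bullet> rho < 0" "\<not> \<gamma> \<bullet> rho < 0" | "\<gamma> \<bullet> rho < 0" "\<not> \<beta> \<bullet> rho < 0"
    unfolding shift_def by (auto split: if_splits)
  then show False
  proof cases
    case 1
    show False by (rule * [OF bc(1,2,3) 1])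
  next
    case 2
    have "- \<theta> = \<gamma> + \<beta>" using bc(3) by (simp only: add.commute)
    then show False by (rule * [OF bc(2,1) _ 2])
  qed
qed

text \<open>Since \<open>\<beta> \<bullet> \<beta> > 0\<close>, some simple root \<open>\<alpha>\<close> that occurs in \<open>\<beta>\<close> has \<open>\<beta> \<bullet> \<alpha> > 0\<close>, and it can be split
  off.\<close>

lemma decomposable_positive:
  assumes "\<beta> \<in> \<Phi>" "\<beta> \<bullet> rho \<ge> 0" "\<beta> \<notin> \<Delta>"
  shows "\<not> indecomposable \<beta>"
proof -
  note ge1 = nonneg_height_root(1) [OF assms(1,2)] and nonneg = nonneg_height_root(2) [OF assms(1,2)]
  have "\<beta> \<noteq> 0" using assms(1) root_system by (auto simp: root_system_def)
  then have "(\<Sum>\<alpha>\<in>\<Delta>. (\<beta> \<bullet> coweight \<alpha>) * (\<alpha> \<bullet> \<beta>)) > 0"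
    unfolding inner_expansion [of \<beta> \<beta>, symmetric] by simp
  then obtain \<alpha> where a: "\<alpha> \<in> \<Delta>" "(\<beta> \<bullet> coweight \<alpha>) * (\<alpha> \<bullet> \<beta>) > 0"
    by (meson not_le sum_nonpos)
  with nonneg [OF a(1)] have pos: "\<beta> \<bullet> coweight \<alpha> > 0" "\<beta> \<bullet> \<alpha> > 0"
    by (auto simp: zero_less_mult_iff inner_commute)
  have mem: "\<beta> - \<alpha> \<in> \<Phi>"
    using root_system_diff [OF root_system assms(1) base_root [OF a(1)] pos(2)] a assms(3) by blast
  have "(\<beta> - \<alpha>) \<bullet> rho \<ge> 0"
    using ge1 inner_rho_base [OF a(1)] by (simp add: inner_diff_left)
  then have "shift (\<beta> - \<alpha>) + shift \<alpha> = shift \<beta>"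
    using assms(2) shift_base [OF a(1)] by (simp add: shift_def)
  moreover have "\<beta> = (\<beta> - \<alpha>) + \<alpha>" by simp
  ultimately show ?thesis
    unfolding indecomposable_def using mem base_root [OF a(1)] by blast
qed

text \<open>It suffices to find a positive root \<open>\<gamma>\<close> for which \<open>\<beta> + \<gamma>\<close> is a root, because then
  \<open>- \<beta> = - (\<beta> + \<gamma>) + \<gamma>\<close>. If \<open>\<theta> \<bullet> \<beta> > 0\<close>, take \<open>\<gamma> = \<theta> - \<beta>\<close>. Otherwise \<open>\<beta>\<close> is not dominant, as all
  coefficients of \<open>\<theta>\<close> are positive, and \<open>\<gamma>\<close> can be chosen simple.\<close>

lemma decomposable_negative:
  assumes "\<beta> \<in> \<Phi>" "\<beta> \<bullet> rho \<ge> 0" "\<beta> \<noteq> \<theta>"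
  shows "\<not> indecomposable (- \<beta>)"
proof -
  note ge1 = nonneg_height_root(1) [OF assms(1,2)] and nonneg = nonneg_height_root(2) [OF assms(1,2)]
  have "\<exists>\<gamma>\<in>\<Phi>. \<gamma> \<bullet> rho > 0 \<and> \<beta> + \<gamma> \<in> \<Phi>"
  proof (cases "\<theta> \<bullet> \<beta> > 0")
    case True
    then have mem: "\<theta> - \<beta> \<in> \<Phi>"
      using root_system_diff [OF root_system highest_root assms(1)] assms(3) by blast
    have "(\<theta> - \<beta>) \<bullet> rho \<ge> 0"
      using height_le_highest [OF assms(1)] by (simp add: inner_diff_left)
    then have "(\<theta> - \<beta>) \<bullet> rho > 0"
      using nonneg_height_root(1) [OF mem] by simp
    with mem highest_root show ?thesis by (intro bexI [of _ "\<theta> - \<beta>"]) auto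
  next
    case False
    have "\<exists>\<alpha>\<in>\<Delta>. \<beta> \<bullet> \<alpha> < 0"
    proof (rule ccontr)
      assume "\<not> ?thesis"
      then have dom: "\<beta> \<bullet> \<alpha> \<ge> 0" if "\<alpha> \<in> \<Delta>" for \<alpha> using that by force
      have le: "\<alpha> \<bullet> \<beta> \<le> (\<theta> \<bullet> coweight \<alpha>) * (\<alpha> \<bullet> \<beta>)" if "\<alpha> \<in> \<Delta>" for \<alpha>
        using highest_coefficient_ge_1 [OF that] dom [OF that]
        by (simp add: inner_commute mult_le_cancel_right1)
      have "(\<Sum>\<alpha>\<in>\<Delta>. \<alpha> \<bullet> \<beta>) \<le> \<theta> \<bullet> \<beta>"
        unfolding inner_expansion [of \<theta> \<beta>] using le by (rule sum_mono)
      then have "(\<Sum>\<alpha>\<in>\<Delta>. \<alpha> \<bullet> \<beta>) = 0"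
        using False dom by (intro antisym sum_nonneg) (auto simp: inner_commute)
      then have "\<alpha> \<bullet> \<beta> = \<alpha> \<bullet> 0" if "\<alpha> \<in> \<Delta>" for \<alpha>
        using that dom finite_base by (auto simp: sum_nonneg_eq_0_iff inner_commute)
      then have "\<beta> = 0" by (rule inner_base_inj)
      then show False using ge1 by simp
    qed
    then obtain \<alpha> where a: "\<alpha> \<in> \<Delta>" "\<beta> \<bullet> \<alpha> < 0" by blast
    have "\<beta> \<noteq> - \<alpha>" using ge1 inner_rho_base [OF a(1)] by auto
    then have "\<beta> - - \<alpha> \<in> \<Phi>"
      using root_system_diff [OF root_system assms(1) root_system_uminus [OF root_system base_root [OF a(1)]]] a(2)
      by simp
    then show ?thesis using a base_root inner_rho_base [OF a(1)] by (intro bexI [of _ \<alpha>]) auto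
  qed
  then obtain \<gamma> where g: "\<gamma> \<in> \<Phi>" "\<gamma> \<bullet> rho > 0" "\<beta> + \<gamma> \<in> \<Phi>" by blast
  have "shift (- (\<beta> + \<gamma>)) + shift \<gamma> = shift (- \<beta>)"
    using g ge1 by (auto simp: shift_def inner_add_left inner_diff_left)
  moreover have "- \<beta> = - (\<beta> + \<gamma>) + \<gamma>" by simp
  ultimately show ?thesis
    unfolding indecomposable_def using g root_system_uminus [OF root_system g(3)] by blast
qed

lemma indecomposable_iff:
  assumes "a \<in> \<Phi>"
  shows "indecomposable a \<longleftrightarrow> a \<in> extended_base"
proof
  assume "indecomposable a"
  moreover have "a \<bullet> rho \<ge> 0 \<or> - a \<bullet> rho \<ge> 0" by auto
  ultimately show "a \<in> extended_base"
    using decomposable_positive [OF assms] decomposable_negative [OF root_system_uminus [OF root_system assms]]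
    unfolding extended_base_def by (metis insertI1 insertI2 minus_minus)
qed (auto simp: extended_base_def indecomposable_simple indecomposable_minus_highest)

section \<open>Marks\<close>

text \<open>The marks of the affine Dynkin diagram: the coefficients of \<open>\<theta>\<close>, and \<open>1\<close> at the affine node.\<close>

definition mark :: "'a \<Rightarrow> nat" where
  "mark a = (if a = - \<theta> then 1 else nat \<lfloor>\<theta> \<bullet> coweight a\<rfloor>)"

lemma mark_minus_highest: "mark (- \<theta>) = 1"
  by (simp add: mark_def)

lemma real_mark:
  assumes "\<alpha> \<in> \<Delta>"
  shows "real (mark \<alpha>) = \<theta> \<bullet> coweight \<alpha>"
proof -
  have "\<alpha> \<noteq> - \<theta>" using assms highest_not_simple by auto
  moreover obtain k where "\<theta> \<bullet> coweight \<alpha> = of_int k"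
    using root_coefficient_Ints [OF highest_root assms] by (auto elim: Ints_cases)
  ultimately show ?thesis
    using highest_coefficient_ge_1 [OF assms] by (simp add: mark_def)
qed

lemma mark_pos: "a \<in> extended_base \<Longrightarrow> mark a > 0"
  using real_mark highest_coefficient_ge_1 by (fastforce simp: extended_base_def mark_minus_highest)

lemma sum_extended_base:
  "sum f extended_base = f (- \<theta>) + sum f \<Delta>" for f :: "'a \<Rightarrow> 'b::comm_monoid_add"
  by (simp add: extended_base_def finite_base highest_not_simple)

lemma mark_relation: "(\<Sum>a\<in>extended_base. real (mark a) *\<^sub>R a) = 0"
proof -
  have "(\<Sum>a\<in>\<Delta>. real (mark a) *\<^sub>R a) = \<theta>"
    by (subst (2) expansion [of \<theta>]) (simp add: real_mark)
  then show ?thesis by (simp add: sum_extended_base mark_minus_highest)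
qed

lemma mark_relation_inner: "(\<Sum>a\<in>extended_base. real (mark a) * (a \<bullet> y)) = 0"
  using arg_cong [OF mark_relation, of "\<lambda>v. v \<bullet> y"] by (simp add: inner_sum_left)

lemma mark_relation_unique:
  assumes "(\<Sum>a\<in>extended_base. f a *\<^sub>R a) = 0" "a \<in> extended_base"
  shows "f a = f (- \<theta>) * real (mark a)"
proof (cases "a \<in> \<Delta>")
  case True
  have "(\<Sum>\<beta>\<in>\<Delta>. f \<beta> *\<^sub>R \<beta>) = f (- \<theta>) *\<^sub>R \<theta>"
    using assms(1) by (simp add: sum_extended_base)
  then have "f a = (f (- \<theta>) *\<^sub>R \<theta>) \<bullet> coweight a"
    using coefficient [OF True, of f] by simp
  then show ?thesis using real_mark [OF True] by simp
qed (use assms in \<open>auto simp: extended_base_def mark_minus_highest\<close>)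

definition diagram_group :: "('a \<Rightarrow> 'a) set" where
  "diagram_group = {v \<in> W. v ` extended_base = extended_base}"

lemma diagram_group_inv:
  assumes "v \<in> diagram_group"
  shows "inv v \<in> diagram_group"
proof -
  have "inv v ` extended_base = inv v ` (v ` extended_base)"
    using assms by (simp add: diagram_group_def)
  also have "\<dots> = extended_base"
  proof -
    have "inv v (v a) = a" for a
      using assms by (auto simp: diagram_group_def weyl_group_inv_cancel)
    then show ?thesis by (simp only: image_image image_ident)
  qed
  finally show ?thesis using assms by (simp add: diagram_group_def weyl_group_inv)
qed

lemma diagram_group_bij_betw:
  assumes "v \<in> diagram_group"
  shows "bij_betw v extended_base extended_base"
  using assms weyl_group_bij unfolding diagram_group_def bij_betw_def
  by (blast intro: inj_on_subset dest: bij_is_inj)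

text \<open>Up to a factor, the marks are the only linear relation on the extended base. Applying \<open>v\<close> to that
  relation gives another one, and comparing the sums of the marks shows that the factor is \<open>1\<close>.\<close>

lemma diagram_group_mark:
  assumes v: "v \<in> diagram_group" and a: "a \<in> extended_base"
  shows "mark (v a) = mark a"
proof -
  have W: "v \<in> W" using v by (simp add: diagram_group_def)
  note bij = diagram_group_bij_betw [OF diagram_group_inv [OF v]]
  define c where "c = real (mark (v (- \<theta>)))"
  have lin: "linear (inv v)" using W weyl_group_inv weyl_group_linear by blast
  have "(\<Sum>b\<in>extended_base. real (mark b) *\<^sub>R inv v b) =
      inv v (\<Sum>b\<in>extended_base. real (mark b) *\<^sub>R b)"
    by (simp add: linear_sum [OF lin] linear_cmul [OF lin])
  also have "\<dots> = 0" by (simp add: mark_relation linear_0 [OF lin])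
  also have "(\<Sum>b\<in>extended_base. real (mark b) *\<^sub>R inv v b) =
      (\<Sum>b\<in>extended_base. real (mark (v b)) *\<^sub>R b)"
    by (subst sum.reindex_bij_betw [OF bij, symmetric]) (simp add: weyl_group_inv_cancel [OF W])
  finally have *: "real (mark (v b)) = c * real (mark b)" if "b \<in> extended_base" for b
    unfolding c_def using mark_relation_unique [of "\<lambda>b. real (mark (v b))"] that by blast
  have "(\<Sum>b\<in>extended_base. real (mark b)) = (\<Sum>b\<in>extended_base. real (mark (v b)))"
    by (rule sum.reindex_bij_betw [OF diagram_group_bij_betw [OF v], symmetric])
  also have "\<dots> = c * (\<Sum>b\<in>extended_base. real (mark b))"
    using * by (simp add: sum_distrib_left)
  moreover have "(\<Sum>b\<in>extended_base. real (mark b)) > 0"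
    using a mark_pos finite_extended_base by (intro sum_pos) auto
  ultimately have "c = 1" by simp
  then show ?thesis using * [OF a] by simp
qed

section \<open>Congruence modulo the coweight lattice\<close>

lemma coweight_lattice_diff: "x \<in> Z \<Longrightarrow> y \<in> Z \<Longrightarrow> x - y \<in> Z"
  and coweight_lattice_add: "x \<in> Z \<Longrightarrow> y \<in> Z \<Longrightarrow> x + y \<in> Z"
  and coweight_lattice_zero: "0 \<in> Z"
  and coweight_lattice_scale: "x \<in> Z \<Longrightarrow> of_int k *\<^sub>R x \<in> Z"
  by (auto simp: coweight_lattice_def inner_diff_right inner_add_right)

lemma weyl_coweight_lattice: "w \<in> W \<Longrightarrow> x \<in> Z \<Longrightarrow> w x \<in> Z"
  using weyl_group_coweight_lattice [OF root_system] by blast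

lemma coweight_lattice_iff: "x \<in> Z \<longleftrightarrow> (\<forall>\<alpha>\<in>\<Delta>. \<alpha> \<bullet> x \<in> \<int>)"
proof
  assume *: "\<forall>\<alpha>\<in>\<Delta>. \<alpha> \<bullet> x \<in> \<int>"
  have "\<beta> \<bullet> x \<in> \<int>" if "\<beta> \<in> \<Phi>" for \<beta>
    unfolding inner_expansion [of \<beta> x]
    using * root_coefficient_Ints [OF that] by (intro Ints_sum Ints_mult) auto
  then show "x \<in> Z" by (simp add: coweight_lattice_def)
qed (auto simp: coweight_lattice_def base_root)

definition lattice_cong :: "int \<Rightarrow> 'a \<Rightarrow> 'a \<Rightarrow> bool" where
  "lattice_cong q x y \<longleftrightarrow> (\<exists>z\<in>Z. x = y + of_int q *\<^sub>R z)"

lemma lattice_cong_refl: "lattice_cong q x x"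
  unfolding lattice_cong_def using coweight_lattice_zero by (intro bexI [of _ 0]) auto

lemma lattice_cong_sym:
  assumes "lattice_cong q x y"
  shows "lattice_cong q y x"
proof -
  obtain z where "z \<in> Z" "x = y + of_int q *\<^sub>R z"
    using assms by (auto simp: lattice_cong_def)
  then show ?thesis
    unfolding lattice_cong_def using coweight_lattice_diff [OF coweight_lattice_zero]
    by (intro bexI [of _ "0 - z"]) auto
qed

lemma lattice_cong_trans:
  assumes "lattice_cong q x y" "lattice_cong q y z"
  shows "lattice_cong q x z"
proof -
  obtain a b where "a \<in> Z" "b \<in> Z" "x = y + of_int q *\<^sub>R a" "y = z + of_int q *\<^sub>R b"
    using assms by (auto simp: lattice_cong_def)
  then show ?thesis
    unfolding lattice_cong_def
    by (intro bexI [of _ "a + b"]) (auto simp: scaleR_add_right coweight_lattice_add)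
qed

lemma lattice_cong_weyl:
  assumes "w \<in> W" "lattice_cong q x y"
  shows "lattice_cong q (w x) (w y)"
proof -
  obtain z where "z \<in> Z" "x = y + of_int q *\<^sub>R z"
    using assms by (auto simp: lattice_cong_def)
  then show ?thesis
    unfolding lattice_cong_def
    using weyl_group_linear [OF assms(1)] weyl_coweight_lattice [OF assms(1)]
    by (intro bexI [of _ "w z"]) (auto simp: linear_add linear_cmul)
qed

lemma lattice_cong_weyl_iff:
  assumes "w \<in> W"
  shows "lattice_cong q (w x) y \<longleftrightarrow> lattice_cong q x (inv w y)"
  using lattice_cong_weyl [OF assms, of q x "inv w y"]
    lattice_cong_weyl [OF weyl_group_inv [OF assms], of q "w x" y] weyl_group_inv_cancel [OF assms]
  by auto

lemma lattice_cong_coweight_lattice: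
  assumes "lattice_cong q x y" "y \<in> Z"
  shows "x \<in> Z"
  using assms coweight_lattice_add coweight_lattice_scale unfolding lattice_cong_def by blast

lemma lattice_cong_inner:
  assumes "lattice_cong q x y" "\<beta> \<in> \<Phi>"
  obtains k :: int where "\<beta> \<bullet> x = \<beta> \<bullet> y + of_int q * of_int k"
proof -
  obtain z where z: "z \<in> Z" "x = y + of_int q *\<^sub>R z"
    using assms by (auto simp: lattice_cong_def)
  then obtain k where "\<beta> \<bullet> z = of_int k"
    using assms(2) by (auto simp: coweight_lattice_def elim: Ints_cases)
  then show thesis using z that [of k] by (simp add: inner_add_right)
qed

lemma lattice_congI:
  assumes "q > 0" "\<And>\<alpha>. \<alpha> \<in> \<Delta> \<Longrightarrow> \<exists>k::int. \<alpha> \<bullet> x = \<alpha> \<bullet> y + of_int q * of_int k"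
  shows "lattice_cong q x y"
proof -
  define z where "z = (1 / of_int q) *\<^sub>R (x - y)"
  have "\<alpha> \<bullet> z \<in> \<int>" if a: "\<alpha> \<in> \<Delta>" for \<alpha>
  proof -
    obtain k :: int where "\<alpha> \<bullet> x = \<alpha> \<bullet> y + of_int q * of_int k" using assms(2) [OF a] ..
    then have "\<alpha> \<bullet> z = of_int k" using assms(1) by (simp add: z_def inner_diff_right)
    then show ?thesis by simp
  qed
  then have "z \<in> Z" by (simp add: coweight_lattice_iff)
  moreover have "x = y + of_int q *\<^sub>R z" using assms(1) by (simp add: z_def)
  ultimately show ?thesis unfolding lattice_cong_def by blast
qed

lemma coweight_coset_eq_iff:
  "coweight_coset \<Phi> q x = coweight_coset \<Phi> q y \<longleftrightarrow> lattice_cong q x y"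
proof -
  have mem: "z \<in> coweight_coset \<Phi> q y \<longleftrightarrow> lattice_cong q z y" for z y
    by (auto simp: coweight_coset_def lattice_cong_def)
  show ?thesis
  proof
    assume "coweight_coset \<Phi> q x = coweight_coset \<Phi> q y"
    then show "lattice_cong q x y" using mem lattice_cong_refl by blast
  next
    assume "lattice_cong q x y"
    then show "coweight_coset \<Phi> q x = coweight_coset \<Phi> q y"
      using mem lattice_cong_trans lattice_cong_sym by blast
  qed
qed

section \<open>Lattice points of the dilated fundamental alcove\<close>

text \<open>For \<open>y\<close> in the alcove, \<open>resid q y \<beta>\<close> is the representative of \<open>\<beta> \<bullet> y\<close> modulo \<open>q\<close> in the open interval
  from \<open>0\<close> to \<open>q\<close>.\<close>

definition resid :: "int \<Rightarrow> 'a \<Rightarrow> 'a \<Rightarrow> real" where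
  "resid q y \<beta> = \<beta> \<bullet> y + of_int q * real (shift \<beta>)"

definition alcove_points :: "int \<Rightarrow> 'a set" where
  "alcove_points q = {y \<in> Z. \<forall>a\<in>extended_base. resid q y a > 0}"

lemma alcove_points_iff:
  "y \<in> alcove_points q \<longleftrightarrow> y \<in> Z \<and> (\<forall>\<alpha>\<in>\<Delta>. \<alpha> \<bullet> y > 0) \<and> \<theta> \<bullet> y < of_int q"
  using shift_highest by (auto simp: alcove_points_def extended_base_def resid_def shift_base)

lemma alcove_positive_root:
  assumes y: "y \<in> alcove_points q" and b: "\<beta> \<in> \<Phi>" "\<beta> \<bullet> rho \<ge> 0"
  shows "0 < \<beta> \<bullet> y" "\<beta> \<bullet> y < of_int q"
proof -
  note nonneg = nonneg_height_root(2) [OF b]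
  have pos: "\<alpha> \<bullet> y > 0" if "\<alpha> \<in> \<Delta>" for \<alpha>
    using that y by (auto simp: alcove_points_iff)
  obtain \<alpha> where a: "\<alpha> \<in> \<Delta>" "\<beta> \<bullet> coweight \<alpha> \<noteq> 0"
    using root_nonzero_coefficient [OF b(1)] .
  have "\<beta> \<bullet> coweight \<alpha> > 0" using nonneg [OF a(1)] a(2) by simp
  then show "0 < \<beta> \<bullet> y"
    unfolding inner_expansion [of \<beta> y]
    using a pos nonneg
    by (intro sum_pos2 [OF finite_base a(1)] mult_pos_pos mult_nonneg_nonneg) (auto intro: less_imp_le)
  have "\<beta> \<bullet> y \<le> \<theta> \<bullet> y"
    unfolding inner_expansion [of \<beta> y] inner_expansion [of \<theta> y]
    using pos coefficient_le_highest [OF b(1)]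
    by (intro sum_mono mult_right_mono) (auto intro: less_imp_le)
  then show "\<beta> \<bullet> y < of_int q" using y by (auto simp: alcove_points_iff)
qed

lemma resid_bounds:
  assumes y: "y \<in> alcove_points q" and b: "\<beta> \<in> \<Phi>"
  shows "0 < resid q y \<beta>" "resid q y \<beta> < of_int q"
proof -
  have "0 < resid q y \<beta> \<and> resid q y \<beta> < of_int q"
  proof (cases "\<beta> \<bullet> rho < 0")
    case True
    then have "0 \<le> (- \<beta>) \<bullet> rho" by simp
    from alcove_positive_root [OF y root_system_uminus [OF root_system b] this]
    show ?thesis using True by (simp add: resid_def shift_def)
  next
    case False
    then show ?thesis using alcove_positive_root [OF y b] by (simp add: resid_def shift_def)
  qed
  then show "0 < resid q y \<beta>" "resid q y \<beta> < of_int q" by simp_all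
qed

lemma alcove_points_regular:
  assumes "y \<in> alcove_points q" "\<beta> \<in> \<Phi>"
  shows "\<beta> \<bullet> y \<noteq> of_int (q * k)"
proof
  assume eq: "\<beta> \<bullet> y = of_int (q * k)"
  have "0 < (of_int (q * (k + int (shift \<beta>))) :: real) \<and> of_int (q * (k + int (shift \<beta>))) < (of_int q :: real)"
    using resid_bounds [OF assms] eq by (simp add: resid_def algebra_simps)
  then have *: "0 < q * (k + int (shift \<beta>))" "q * (k + int (shift \<beta>)) < q * 1"
    by (simp_all only: of_int_less_iff of_int_0_less_iff mult_1_right)
  then have "0 < q" by linarith
  with * have "0 < k + int (shift \<beta>)" "k + int (shift \<beta>) < 1"
    by (simp_all only: zero_less_mult_iff mult_less_cancel_left_pos) auto
  then show False by linarith
qed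

text \<open>Both sides lie strictly between \<open>0\<close> and \<open>q\<close> and differ by a multiple of \<open>q\<close>.\<close>

lemma resid_cong:
  assumes y: "y \<in> alcove_points q" "y' \<in> alcove_points q" and v: "v \<in> W"
    and cong: "lattice_cong q y' (v y)" and a: "a \<in> \<Phi>"
  shows "resid q y' a = resid q y (inv v a)"
proof -
  obtain k where k: "a \<bullet> y' = a \<bullet> v y + of_int q * of_int k"
    using lattice_cong_inner [OF cong a] .
  have va: "inv v a \<in> \<Phi>" using weyl_group_root [OF root_system weyl_group_inv [OF v] a] .
  define j where "j = k + int (shift a) - int (shift (inv v a))"
  have d: "resid q y' a - resid q y (inv v a) = of_int (q * j)"
    unfolding resid_def k weyl_group_adjoint(2) [OF v] j_def by (simp add: algebra_simps)
  then have "of_int (q * j) < (of_int q :: real)" "- (of_int q :: real) < of_int (q * j)"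
    using resid_bounds [OF y(1) va] resid_bounds [OF y(2) a] by linarith+
  then have *: "q * j < q * 1" "q * (- 1) < q * j" by linarith+
  have "0 < q" using * by linarith
  with * have "j < 1" "- 1 < j" by (simp_all only: mult_less_cancel_left_pos)
  then have "j = 0" by linarith
  with d show ?thesis by simp
qed

text \<open>Whether the shifts of \<open>\<beta>\<close> and \<open>\<gamma>\<close> add up to that of \<open>\<beta> + \<gamma>\<close> is visible in the residues at any point
  of the alcove, and these are carried along by \<open>v\<close>. So \<open>v\<close> preserves indecomposability.\<close>

lemma diagram_groupI:
  assumes y: "y \<in> alcove_points q" "y' \<in> alcove_points q" and v: "v \<in> W"
    and cong: "lattice_cong q y' (v y)"
  shows "v \<in> diagram_group"
proof -
  have q: "q > 0"
    using resid_bounds [OF y(1) highest_root] by (metis less_trans of_int_0_less_iff)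
  have lin: "linear (inv v)" using v weyl_group_inv weyl_group_linear by blast
  note resid = resid_cong [OF y v cong]
  have shift_iff: "shift \<beta> + shift \<gamma> = shift (\<beta> + \<gamma>) \<longleftrightarrow>
      resid q y \<beta> + resid q y \<gamma> = resid q y (\<beta> + \<gamma>)" for y \<beta> \<gamma>
  proof -
    have "resid q y \<beta> + resid q y \<gamma> - resid q y (\<beta> + \<gamma>) =
        of_int q * (real (shift \<beta> + shift \<gamma>) - real (shift (\<beta> + \<gamma>)))"
      by (simp add: resid_def inner_add_left algebra_simps)
    moreover have "\<dots> = 0 \<longleftrightarrow> shift \<beta> + shift \<gamma> = shift (\<beta> + \<gamma>)"
      using q by (simp flip: of_nat_add)
    ultimately show ?thesis by (metis eq_iff_diff_eq_0)
  qed
  have "v b \<in> extended_base" if b: "b \<in> extended_base" for b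
  proof -
    have bR: "b \<in> \<Phi>" using extended_base_root [OF b] .
    have "indecomposable (v b)"
      unfolding indecomposable_def
    proof (intro ballI impI notI)
      fix \<beta> \<gamma> assume bc: "\<beta> \<in> \<Phi>" "\<gamma> \<in> \<Phi>" "v b = \<beta> + \<gamma>" "shift \<beta> + shift \<gamma> = shift (v b)"
      have sum: "inv v \<beta> + inv v \<gamma> = b"
        using bc(3) weyl_group_inv_cancel [OF v] linear_add [OF lin] by metis
      have "resid q y' \<beta> + resid q y' \<gamma> = resid q y' (v b)"
        using bc shift_iff by metis
      then have "resid q y (inv v \<beta>) + resid q y (inv v \<gamma>) = resid q y b"
        using resid bc weyl_group_root [OF root_system v bR] weyl_group_inv_cancel [OF v] by metis
      then have "shift (inv v \<beta>) + shift (inv v \<gamma>) = shift b"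
        using sum shift_iff by metis
      moreover have "inv v \<beta> \<in> \<Phi>" "inv v \<gamma> \<in> \<Phi>"
        using weyl_group_root [OF root_system weyl_group_inv [OF v]] bc by auto
      moreover have "indecomposable b" using indecomposable_iff [OF bR] b by simp
      ultimately show False using sum unfolding indecomposable_def by metis
    qed
    then show ?thesis using indecomposable_iff weyl_group_root [OF root_system v bR] by blast
  qed
  then have "v ` extended_base \<subseteq> extended_base" by blast
  moreover have "inj_on v extended_base"
    using weyl_group_bij [OF v] bij_is_inj inj_on_subset by blast
  ultimately have "v ` extended_base = extended_base"
    by (simp add: endo_inj_surj finite_extended_base)
  then show ?thesis using v by (simp add: diagram_group_def)
qed

lemma resid_sum: "(\<Sum>a\<in>extended_base. real (mark a) * resid q y a) = of_int q"
proof -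
  have "(\<Sum>a\<in>extended_base. real (mark a) * resid q y a) =
      (\<Sum>a\<in>extended_base. real (mark a) * (a \<bullet> y)) +
      (\<Sum>a\<in>extended_base. real (mark a) * (of_int q * real (shift a)))"
    by (simp add: resid_def distrib_left sum.distrib)
  also have "(\<Sum>a\<in>extended_base. real (mark a) * (of_int q * real (shift a))) = of_int q"
    by (simp add: sum_extended_base mark_minus_highest shift_highest shift_base)
  finally show ?thesis by (simp add: mark_relation_inner)
qed

lemma resid_inj:
  assumes "\<And>a. a \<in> extended_base \<Longrightarrow> resid q y a = resid q y' a"
  shows "y = y'"
  by (rule inner_base_inj) (use assms in \<open>force simp: extended_base_def resid_def\<close>)

text \<open>The residues at the extended base are barycentric coordinates, bound only by the relation
  \<open>resid_sum\<close>.\<close>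

lemma resid_surj:
  assumes "(\<Sum>a\<in>extended_base. real (mark a) * f a) = of_int q"
  obtains y where "\<And>a. a \<in> extended_base \<Longrightarrow> resid q y a = f a"
proof -
  obtain y where y: "\<And>\<alpha>. \<alpha> \<in> \<Delta> \<Longrightarrow> \<alpha> \<bullet> y = f \<alpha>"
    using inner_base_surj [of f] by blast
  then have base: "resid q y \<alpha> = f \<alpha>" if "\<alpha> \<in> \<Delta>" for \<alpha>
    using that by (simp add: resid_def shift_base)
  then have "resid q y (- \<theta>) = f (- \<theta>)"
    using assms resid_sum [of q y] by (simp add: sum_extended_base mark_minus_highest)
  with base that show thesis by (auto simp: extended_base_def)
qed

lemma finite_bounded_coweights: "finite {y \<in> Z. \<forall>\<alpha>\<in>\<Delta>. \<bar>\<alpha> \<bullet> y\<bar> \<le> K}"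
proof -
  let ?S = "{y \<in> Z. \<forall>\<alpha>\<in>\<Delta>. \<bar>\<alpha> \<bullet> y\<bar> \<le> K}"
  let ?f = "\<lambda>y. \<lambda>\<alpha>\<in>\<Delta>. \<lfloor>\<alpha> \<bullet> y\<rfloor>"
  have "inj_on ?f ?S"
  proof (rule inj_onI, rule inner_base_inj)
    fix x y \<alpha> assume xy: "x \<in> ?S" "y \<in> ?S" "?f x = ?f y" and a: "\<alpha> \<in> \<Delta>"
    have "\<lfloor>\<alpha> \<bullet> x\<rfloor> = \<lfloor>\<alpha> \<bullet> y\<rfloor>" using xy(3) a by (metis restrict_apply')
    moreover have "\<alpha> \<bullet> x \<in> \<int>" "\<alpha> \<bullet> y \<in> \<int>" using xy a coweight_lattice_iff by auto
    ultimately show "\<alpha> \<bullet> x = \<alpha> \<bullet> y" by (metis Ints_cases of_int_floor_cancel)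
  qed
  moreover have "?f ` ?S \<subseteq> \<Delta> \<rightarrow>\<^sub>E {- \<lceil>K\<rceil>..\<lceil>K\<rceil>}"
  proof (intro image_subsetI)
    fix y assume y: "y \<in> ?S"
    have "\<lfloor>\<alpha> \<bullet> y\<rfloor> \<in> {- \<lceil>K\<rceil>..\<lceil>K\<rceil>}" if "\<alpha> \<in> \<Delta>" for \<alpha>
    proof -
      have "- K \<le> \<alpha> \<bullet> y" "\<alpha> \<bullet> y \<le> K" using y that by (auto simp: abs_le_iff)
      then have "\<lfloor>- K\<rfloor> \<le> \<lfloor>\<alpha> \<bullet> y\<rfloor>" "\<lfloor>\<alpha> \<bullet> y\<rfloor> \<le> \<lceil>K\<rceil>"
        by (auto intro: floor_mono order_trans [OF floor_mono floor_le_ceiling])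
      then show ?thesis by (simp add: floor_minus)
    qed
    then show "?f y \<in> \<Delta> \<rightarrow>\<^sub>E {- \<lceil>K\<rceil>..\<lceil>K\<rceil>}" by auto
  qed
  moreover have "finite (\<Delta> \<rightarrow>\<^sub>E {- \<lceil>K\<rceil>..\<lceil>K\<rceil>})" using finite_base by (intro finite_PiE) auto
  ultimately show ?thesis using finite_imageD finite_subset by blast
qed

lemma finite_alcove_points: "finite (alcove_points q)"
proof (rule finite_subset [OF _ finite_bounded_coweights])
  show "alcove_points q \<subseteq> {y \<in> Z. \<forall>\<alpha>\<in>\<Delta>. \<bar>\<alpha> \<bullet> y\<bar> \<le> of_int q}"
  proof (intro subsetI CollectI conjI ballI)
    fix y \<alpha> assume y: "y \<in> alcove_points q" and a: "\<alpha> \<in> \<Delta>"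
    have "0 \<le> \<alpha> \<bullet> rho" using inner_rho_base [OF a] by simp
    from alcove_positive_root [OF y base_root [OF a] this] show "\<bar>\<alpha> \<bullet> y\<bar> \<le> of_int q" by simp
  qed (simp add: alcove_points_iff)
qed

lemma coroot_coweight_lattice:
  assumes "\<alpha> \<in> \<Phi>"
  shows "(2 / (\<alpha> \<bullet> \<alpha>)) *\<^sub>R \<alpha> \<in> Z"
  using assms root_system by (auto simp: coweight_lattice_def root_system_def)

lemma finite_norm_bounded_coweights: "finite {y \<in> Z. norm (y - p) \<le> R}"
proof (rule finite_subset [OF _ finite_bounded_coweights])
  let ?K = "(\<Sum>\<alpha>\<in>\<Delta>. norm \<alpha>) * (R + norm p)"
  show "{y \<in> Z. norm (y - p) \<le> R} \<subseteq> {y \<in> Z. \<forall>\<alpha>\<in>\<Delta>. \<bar>\<alpha> \<bullet> y\<bar> \<le> ?K}"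
  proof clarify
    fix y \<alpha> assume y: "norm (y - p) \<le> R" and a: "\<alpha> \<in> \<Delta>"
    have "norm y \<le> R + norm p" using y norm_triangle_ineq2 [of y p] by linarith
    moreover have "norm \<alpha> \<le> (\<Sum>\<alpha>\<in>\<Delta>. norm \<alpha>)"
      using a finite_base by (intro member_le_sum) auto
    ultimately have "norm \<alpha> * norm y \<le> ?K"
      by (intro mult_mono) (auto intro: sum_nonneg)
    then show "\<bar>\<alpha> \<bullet> y\<bar> \<le> ?K"
      using Cauchy_Schwarz_ineq2 [of \<alpha> y] by linarith
  qed
qed

text \<open>Reflecting in a hyperplane that separates \<open>y\<close> from \<open>p\<close> brings \<open>y\<close> closer to \<open>p\<close>.\<close>

lemma refl_along_closer:
  assumes "\<alpha> \<in> \<Phi>" "\<alpha> \<bullet> p > c" "\<alpha> \<bullet> y < c"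
  shows "norm (refl_along \<alpha> y + (2 * c / (\<alpha> \<bullet> \<alpha>)) *\<^sub>R \<alpha> - p) < norm (y - p)"
proof -
  have pos: "\<alpha> \<bullet> \<alpha> > 0" using assms(1) root_system by (auto simp: root_system_def)
  define d where "d = 2 * (c - \<alpha> \<bullet> y) / (\<alpha> \<bullet> \<alpha>)"
  have eq: "refl_along \<alpha> y + (2 * c / (\<alpha> \<bullet> \<alpha>)) *\<^sub>R \<alpha> - p = (y - p) + d *\<^sub>R \<alpha>"
    by (simp add: refl_along_def d_def inner_commute diff_divide_distrib
        right_diff_distrib scaleR_left_diff_distrib)
  have "d > 0" using assms pos by (simp add: d_def)
  have sq: "d * (\<alpha> \<bullet> \<alpha>) = 2 * (c - \<alpha> \<bullet> y)" using pos by (simp add: d_def)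
  have "((y - p) + d *\<^sub>R \<alpha>) \<bullet> ((y - p) + d *\<^sub>R \<alpha>) =
      (y - p) \<bullet> (y - p) + d * (2 * (\<alpha> \<bullet> y) - 2 * (\<alpha> \<bullet> p) + d * (\<alpha> \<bullet> \<alpha>))"
    by (simp add: inner_add_left inner_add_right inner_diff_left inner_diff_right inner_commute
        algebra_simps)
  also have "\<dots> = (y - p) \<bullet> (y - p) - d * (2 * (\<alpha> \<bullet> p - c))"
    unfolding sq by (simp add: algebra_simps)
  also have "\<dots> < (y - p) \<bullet> (y - p)"
    using \<open>d > 0\<close> assms(2) by simp
  finally show ?thesis unfolding eq by (simp add: norm_lt)
qed

text \<open>Among all points of the orbit of \<open>x\<close> under \<open>W\<close> and the translations by \<open>qZ\<close>, take one that is
  closest to a point \<open>p\<close> inside the alcove. No reflecting hyperplane separates it from \<open>p\<close>, since the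
  reflection would bring it closer; and it lies on no hyperplane, since \<open>x\<close> is regular.\<close>

lemma alcove_representative:
  assumes q: "q > 0" and x: "x \<in> Z" and reg: "\<And>\<beta> k::int. \<beta> \<in> \<Phi> \<Longrightarrow> \<beta> \<bullet> x \<noteq> of_int (q * k)"
  obtains u y where "u \<in> W" "y \<in> alcove_points q" "lattice_cong q (u y) x"
proof -
  \<comment> \<open>The point of the alcove whose residues at the whole extended base are equal.\<close>
  define p where "p = (of_int q / (1 + \<theta> \<bullet> rho)) *\<^sub>R rho"
  have p: "\<alpha> \<bullet> p > 0" if "\<alpha> \<in> \<Delta>" for \<alpha>
    using that q height_highest by (simp add: p_def inner_rho_base)
  have "\<theta> \<bullet> p < of_int q"
    using q height_highest by (simp add: p_def field_simps)
  then have p0: "- \<theta> \<bullet> p > - of_int q" by simp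
  define Orb where "Orb = {y. \<exists>u\<in>W. lattice_cong q (u y) x}"
  have OrbZ: "y \<in> Z" if "y \<in> Orb" for y
  proof -
    obtain u where u: "u \<in> W" "lattice_cong q (u y) x" using \<open>y \<in> Orb\<close> by (auto simp: Orb_def)
    then have "inv u (u y) \<in> Z"
      using lattice_cong_coweight_lattice x weyl_coweight_lattice weyl_group_inv by metis
    then show ?thesis using weyl_group_inv_cancel [OF u(1)] by simp
  qed
  have Orb_regular: "\<beta> \<bullet> y \<noteq> of_int (q * k)" if "y \<in> Orb" "\<beta> \<in> \<Phi>" for y \<beta> k
  proof
    assume eq: "\<beta> \<bullet> y = of_int (q * k)"
    obtain u where u: "u \<in> W" "lattice_cong q (u y) x" using \<open>y \<in> Orb\<close> by (auto simp: Orb_def)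
    have root: "u \<beta> \<in> \<Phi>" using weyl_group_root [OF root_system u(1) that(2)] .
    obtain j where "u \<beta> \<bullet> x = u \<beta> \<bullet> u y + of_int q * of_int j"
      using lattice_cong_inner [OF lattice_cong_sym [OF u(2)] root] .
    then have "u \<beta> \<bullet> x = of_int (q * (k + j))"
      using eq weyl_group_inner [OF u(1)] by (simp add: algebra_simps)
    with reg [OF root] show False by blast
  qed
  \<comment> \<open>The affine reflection in the hyperplane \<open>\<alpha> \<bullet> z = q * k\<close>.\<close>
  have Orb_refl: "refl_along \<alpha> y + (2 * of_int (q * k) / (\<alpha> \<bullet> \<alpha>)) *\<^sub>R \<alpha> \<in> Orb"
    if "y \<in> Orb" "\<alpha> \<in> \<Phi>" for y \<alpha> k
  proof -
    obtain u where u: "u \<in> W" "lattice_cong q (u y) x" using \<open>y \<in> Orb\<close> by (auto simp: Orb_def)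
    define y' where "y' = refl_along \<alpha> y + (2 * of_int (q * k) / (\<alpha> \<bullet> \<alpha>)) *\<^sub>R \<alpha>"
    have "y' = refl_along \<alpha> y + of_int q *\<^sub>R (of_int k *\<^sub>R ((2 / (\<alpha> \<bullet> \<alpha>)) *\<^sub>R \<alpha>))"
      by (simp add: y'_def mult.commute)
    then have "lattice_cong q y' (refl_along \<alpha> y)"
      unfolding lattice_cong_def
      using coweight_lattice_scale [OF coroot_coweight_lattice [OF that(2)]] by blast
    then have "lattice_cong q (refl_along \<alpha> y') y"
      using lattice_cong_weyl [OF weyl_group_refl_along [OF that(2)]] refl_along_involution by metis
    then have "lattice_cong q (u (refl_along \<alpha> y')) x"
      using lattice_cong_weyl [OF u(1)] lattice_cong_trans u(2) by blast
    then have "lattice_cong q ((u \<circ> refl_along \<alpha>) y') x" by simp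
    then show ?thesis
      unfolding Orb_def y'_def [symmetric]
      using weyl_group_compose [OF u(1) weyl_group_refl_along [OF that(2)]] by blast
  qed
  have xO: "x \<in> Orb"
    unfolding Orb_def using weyl_group.weyl_id lattice_cong_refl by (metis (mono_tags) id_apply mem_Collect_eq)
  define F where "F = {y \<in> Orb. norm (y - p) \<le> norm (x - p)}"
  have "finite F"
    by (rule finite_subset [OF _ finite_norm_bounded_coweights [of p "norm (x - p)"]])
      (auto simp: F_def OrbZ)
  moreover have "F \<noteq> {}" using xO by (auto simp: F_def)
  ultimately obtain y where y: "y \<in> F" and min: "\<And>z. z \<in> F \<Longrightarrow> norm (y - p) \<le> norm (z - p)"
    using ex_min_if_finite [of "(\<lambda>y. norm (y - p)) ` F"] by (auto simp: not_less)
  have yO: "y \<in> Orb" using y by (simp add: F_def)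
  have minO: "norm (y - p) \<le> norm (z - p)" if "z \<in> Orb" for z
    using min [of z] y that by (force simp: F_def)
  have above: "\<alpha> \<bullet> y > of_int (q * k)" if "\<alpha> \<in> \<Phi>" "\<alpha> \<bullet> p > of_int (q * k)" for \<alpha> k
  proof (rule ccontr)
    assume "\<not> ?thesis"
    then have "\<alpha> \<bullet> y < of_int (q * k)" using Orb_regular [OF yO that(1), of k] by linarith
    from refl_along_closer [OF that this] minO [OF Orb_refl [OF yO that(1), of k]]
    show False by simp
  qed
  have "y \<in> alcove_points q"
    using above [of _ 0] above [of "- \<theta>" "- 1"] p p0 OrbZ [OF yO] base_root
      root_system_uminus [OF root_system highest_root]
    by (auto simp: alcove_points_iff)
  moreover obtain u where "u \<in> W" "lattice_cong q (u y) x" using yO by (auto simp: Orb_def)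
  ultimately show thesis using that by blast
qed

text \<open>The bijection sends \<open>(u, y)\<close> to \<open>inv u \<circ> u0\<close>. Conversely \<open>v\<close> determines \<open>u\<close>, and \<open>y\<close> must have the
  residues of \<open>y0\<close> permuted by \<open>v\<close>; such a point exists because \<open>v\<close> preserves the marks.\<close>

lemma card_alcove_fibre:
  assumes q: "q > 0" and u0: "u0 \<in> W" and y0: "y0 \<in> alcove_points q"
  shows "card {(u, y) \<in> W \<times> alcove_points q. lattice_cong q (u y) (u0 y0)} = card diagram_group"
proof (rule bij_betw_same_card)
  let ?S = "{(u, y) \<in> W \<times> alcove_points q. lattice_cong q (u y) (u0 y0)}"
  let ?f = "\<lambda>p. inv (fst p) \<circ> u0"
  have memS: "inv u \<circ> u0 \<in> W" "lattice_cong q y ((inv u \<circ> u0) y0)"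
    if "(u, y) \<in> ?S" for u y
    using that weyl_group_compose [OF weyl_group_inv u0] lattice_cong_weyl_iff by auto
  show "bij_betw ?f ?S diagram_group"
    unfolding bij_betw_def
  proof
    show "inj_on ?f ?S"
    proof (rule inj_onI)
      fix p p' assume p: "p \<in> ?S" "p' \<in> ?S" and eq: "?f p = ?f p'"
      obtain u y u' y' where [simp]: "p = (u, y)" "p' = (u', y')" by (cases p, cases p')
      have uW: "u \<in> W" "u' \<in> W" and yA: "y \<in> alcove_points q" "y' \<in> alcove_points q"
        using p by auto
      have "inv u z = inv u' z" for z
        using fun_cong [OF eq, of "inv u0 z"] weyl_group_inv_cancel [OF u0] by simp
      then have inv_eq: "inv u = inv u'" by blast
      then have "u = u'" using uW weyl_group_bij inv_inv_eq by metis
      have "lattice_cong q y' (id y)"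
        using memS(2) [of u y] memS(2) [of u' y'] p eq lattice_cong_sym lattice_cong_trans
        by (metis \<open>p = (u, y)\<close> \<open>p' = (u', y')\<close> fst_conv id_apply)
      then have "y = y'"
        using resid_cong [OF yA weyl_group.weyl_id] extended_base_root
        by (intro resid_inj [of q]) (simp add: inv_id)
      with \<open>u = u'\<close> show "p = p'" by simp
    qed
    show "?f ` ?S = diagram_group"
    proof (intro equalityI subsetI)
      fix v assume "v \<in> ?f ` ?S"
      then obtain u y where uy: "(u, y) \<in> ?S" "v = inv u \<circ> u0" by auto
      have "y \<in> alcove_points q" using uy(1) by auto
      then show "v \<in> diagram_group"
        unfolding uy(2) by (rule diagram_groupI [OF y0 _ memS [OF uy(1)]])
    next
      fix v assume v: "v \<in> diagram_group"
      have vW: "v \<in> W" using v by (simp add: diagram_group_def)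
      have vD: "inv v a \<in> extended_base" if "a \<in> extended_base" for a
        using diagram_group_inv [OF v] that by (auto simp: diagram_group_def)
      have "(\<Sum>a\<in>extended_base. real (mark a) * resid q y0 (inv v a)) =
          (\<Sum>a\<in>extended_base. real (mark (inv v a)) * resid q y0 (inv v a))"
        using diagram_group_mark [OF diagram_group_inv [OF v]] by simp
      also have "\<dots> = (\<Sum>a\<in>extended_base. real (mark a) * resid q y0 a)"
        by (rule sum.reindex_bij_betw [OF diagram_group_bij_betw [OF diagram_group_inv [OF v]]])
      finally obtain y where y: "\<And>a. a \<in> extended_base \<Longrightarrow> resid q y a = resid q y0 (inv v a)"
        using resid_surj [of "\<lambda>a. resid q y0 (inv v a)" q] by (auto simp: resid_sum)
      have cong: "lattice_cong q y (v y0)"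
      proof (rule lattice_congI [OF q])
        fix \<alpha> assume a: "\<alpha> \<in> \<Delta>"
        then have "\<alpha> \<bullet> y = \<alpha> \<bullet> v y0 + of_int q * of_int (int (shift (inv v \<alpha>)))"
          using y [of \<alpha>] by (simp add: extended_base_def resid_def shift_base weyl_group_adjoint [OF vW])
        then show "\<exists>k::int. \<alpha> \<bullet> y = \<alpha> \<bullet> v y0 + of_int q * of_int k" ..
      qed
      have "y \<in> Z"
        using lattice_cong_coweight_lattice [OF cong] weyl_coweight_lattice [OF vW] y0
        by (simp add: alcove_points_def)
      then have yA: "y \<in> alcove_points q"
        using y vD y0 by (auto simp: alcove_points_def)
      define u where "u = u0 \<circ> inv v"
      have uW: "u \<in> W" unfolding u_def using weyl_group_compose [OF u0 weyl_group_inv [OF vW]] .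
      have "lattice_cong q (u y) (u0 y0)"
        using lattice_cong_weyl [OF uW cong] weyl_group_inv_cancel [OF vW] by (simp add: u_def)
      moreover have "inv u \<circ> u0 = v"
      proof
        fix z
        have "inv u (u (v z)) = v z" by (rule weyl_group_inv_cancel(2) [OF uW])
        then show "(inv u \<circ> u0) z = v z" using weyl_group_inv_cancel(2) [OF vW] by (simp add: u_def)
      qed
      ultimately show "v \<in> ?f ` ?S"
        using uW yA by (intro image_eqI [of _ _ "(u, y)"]) auto
    qed
  qed
qed

text \<open>The cosets fixed by \<open>w\<close> are covered by the pairs \<open>(u, y)\<close> with \<open>w (u y) \<equiv> u y\<close>, and every fibre of this
  covering has as many elements as the diagram group.\<close>

lemma fixed_count_alcove:
  assumes q: "q > 0" and w: "w \<in> W"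
  shows "card diagram_group * fixed_count \<Phi> q w =
    (\<Sum>u\<in>W. card {y \<in> alcove_points q. lattice_cong q ((inv u \<circ> w \<circ> u) y) y})"
proof -
  define P where "P = {(u, y) \<in> W \<times> alcove_points q. lattice_cong q (w (u y)) (u y)}"
  define T where "T = {t \<in> M_set \<Phi> q. w ` t = t}"
  define f where "f = (\<lambda>(u :: 'a \<Rightarrow> 'a, y). coweight_coset \<Phi> q (u y))"
  have finP: "finite P"
    unfolding P_def
    by (rule finite_subset [OF _ finite_cartesian_product [OF finite_weyl_group [OF root_system] finite_alcove_points]])
      auto
  have fT: "f ` P = T"
  proof (intro equalityI subsetI)
    fix t assume "t \<in> f ` P"
    then obtain u y where uy: "u \<in> W" "y \<in> alcove_points q" "lattice_cong q (w (u y)) (u y)"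
      and t: "t = coweight_coset \<Phi> q (u y)" by (auto simp: P_def f_def)
    have "\<not> (\<exists>k::int. \<beta> \<bullet> u y = of_int (q * k))" if "\<beta> \<in> \<Phi>" for \<beta>
      using alcove_points_regular [OF uy(2) weyl_group_root [OF root_system weyl_group_inv [OF uy(1)] that]]
        weyl_group_adjoint(2) [OF uy(1)] by metis
    moreover have "u y \<in> Z" using uy weyl_coweight_lattice by (simp add: alcove_points_def)
    ultimately have "t \<in> M_set \<Phi> q" unfolding M_set_def t by blast
    moreover have "w ` t = t"
      unfolding t weyl_group_coset_action [OF root_system w] coweight_coset_eq_iff by (rule uy(3))
    ultimately show "t \<in> T" by (simp add: T_def)
  next
    fix t assume "t \<in> T"
    then obtain x where t: "t = coweight_coset \<Phi> q x" and x: "x \<in> Z"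
      and reg: "\<And>\<beta>. \<beta> \<in> \<Phi> \<Longrightarrow> \<not> (\<exists>k::int. \<beta> \<bullet> x = of_int (q * k))" and wt: "w ` t = t"
      by (auto simp: T_def M_set_def)
    obtain u y where uy: "u \<in> W" "y \<in> alcove_points q" "lattice_cong q (u y) x"
      using alcove_representative [OF q x] reg by metis
    then have t': "t = coweight_coset \<Phi> q (u y)"
      unfolding t coweight_coset_eq_iff by (blast intro: lattice_cong_sym)
    have "lattice_cong q (w (u y)) (u y)"
      using wt unfolding t' weyl_group_coset_action [OF root_system w] coweight_coset_eq_iff .
    then show "t \<in> f ` P"
      using uy t' by (intro image_eqI [of _ _ "(u, y)"]) (auto simp: P_def f_def)
  qed
  have fibre: "card {p \<in> P. f p = t} = card diagram_group" if "t \<in> T" for t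
  proof -
    obtain u0 y0 where p0: "u0 \<in> W" "y0 \<in> alcove_points q" "lattice_cong q (w (u0 y0)) (u0 y0)"
      and t: "t = coweight_coset \<Phi> q (u0 y0)"
      using \<open>t \<in> T\<close> unfolding fT [symmetric] by (auto simp: P_def f_def)
    have "{p \<in> P. f p = t} = {(u, y) \<in> W \<times> alcove_points q. lattice_cong q (u y) (u0 y0)}"
    proof -
      have stable: "lattice_cong q (w (u y)) (u y)" if "lattice_cong q (u y) (u0 y0)" for u y
        using that lattice_cong_weyl [OF w that] p0(3) lattice_cong_trans lattice_cong_sym by blast
      have f: "f (u, y) = t \<longleftrightarrow> lattice_cong q (u y) (u0 y0)" for u y
        by (simp add: f_def t coweight_coset_eq_iff)
      have pair: "(u, y) \<in> {p \<in> P. f p = t} \<longleftrightarrow>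
          (u, y) \<in> {(u, y) \<in> W \<times> alcove_points q. lattice_cong q (u y) (u0 y0)}" for u y
        using stable [of u y] by (simp add: f P_def) blast
      show ?thesis
      proof (rule set_eqI)
        fix p :: "('a \<Rightarrow> 'a) \<times> 'a"
        show "p \<in> {p \<in> P. f p = t} \<longleftrightarrow>
            p \<in> {(u, y) \<in> W \<times> alcove_points q. lattice_cong q (u y) (u0 y0)}"
          using pair [of "fst p" "snd p"] by (simp only: prod.collapse)
      qed
    qed
    then show ?thesis using card_alcove_fibre [OF q p0(1,2)] by simp
  qed
  have "card P = (\<Sum>t\<in>f ` P. card {p \<in> P. f p = t})"
    using sum.image_gen [OF finP, of "\<lambda>_. 1 :: nat" f] by simp
  also have "\<dots> = card diagram_group * fixed_count \<Phi> q w"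
    unfolding fT fixed_count_def T_def [symmetric] by (simp add: fibre)
  finally have card_P: "card P = card diagram_group * fixed_count \<Phi> q w" .
  have "P = Sigma W (\<lambda>u. {y \<in> alcove_points q. lattice_cong q ((inv u \<circ> w \<circ> u) y) y})"
  proof -
    have "lattice_cong q ((inv u \<circ> w \<circ> u) y) y \<longleftrightarrow> lattice_cong q (w (u y)) (u y)" if "u \<in> W" for u y
      using lattice_cong_weyl_iff [OF weyl_group_inv [OF that], of q "w (u y)" y]
        inv_inv_eq [OF weyl_group_bij [OF that]] by simp
    then show ?thesis by (auto simp: P_def)
  qed
  then have "card P = (\<Sum>u\<in>W. card {y \<in> alcove_points q. lattice_cong q ((inv u \<circ> w \<circ> u) y) y})"
    using finite_alcove_points finite_weyl_group [OF root_system] by (simp add: card_SigmaI)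
  then show ?thesis using card_P by simp
qed

end

section \<open>Orbits of a self-map and invariant functions\<close>

text \<open>Two points are related if no set that is stable under \<open>v\<close> in both directions separates them. On a
  finite set permuted by \<open>v\<close> the classes are the cycles; this description makes invariant functions
  constant on classes without any induction along cycles.\<close>

definition orbit_rel :: "('b \<Rightarrow> 'b) \<Rightarrow> 'b set \<Rightarrow> ('b \<times> 'b) set" where
  "orbit_rel v D = {(a, b) \<in> D \<times> D.
     \<forall>S. (\<forall>x\<in>D. v x \<in> S \<longleftrightarrow> x \<in> S) \<longrightarrow> (a \<in> S \<longleftrightarrow> b \<in> S)}"

lemma equiv_orbit_rel: "equiv D (orbit_rel v D)"
  by (intro equivI refl_onI symI transI) (auto simp: orbit_rel_def)

lemma orbit_rel_image: "v ` D \<subseteq> D \<Longrightarrow> a \<in> D \<Longrightarrow> (a, v a) \<in> orbit_rel v D"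
  by (auto simp: orbit_rel_def)

lemma orbit_rel_invariant:
  assumes "\<And>x. x \<in> D \<Longrightarrow> f (v x) = f x" "(a, b) \<in> orbit_rel v D"
  shows "f a = f b"
proof -
  have "\<forall>x\<in>D. v x \<in> {x. f x = f a} \<longleftrightarrow> x \<in> {x. f x = f a}" using assms(1) by simp
  then have "a \<in> {x. f x = f a} \<longleftrightarrow> b \<in> {x. f x = f a}"
    using assms(2) unfolding orbit_rel_def by blast
  then show ?thesis by simp
qed

lemma sum_over_quotient:
  assumes "finite D" "equiv D R"
  shows "(\<Sum>c\<in>D // R. sum f c) = sum f D"
proof -
  have "sum f (\<Union>(D // R)) = (sum \<circ> sum) f (D // R)"
  proof (rule sum.Union_disjoint)
    show "\<forall>c\<in>D // R. finite c"
      using finite_subset [OF in_quotient_imp_subset [OF assms(2)] assms(1)] by blast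
    show "\<forall>c\<in>D // R. \<forall>d\<in>D // R. c \<noteq> d \<longrightarrow> c \<inter> d = {}"
      using quotient_disj [OF assms(2)] by blast
  qed
  then show ?thesis by (simp add: Union_quotient [OF assms(2)])
qed

lemma card_invariant_functions:
  fixes D :: "'b set"
  assumes D: "finite D" and v: "v ` D \<subseteq> D"
  shows "card {x \<in> D \<rightarrow>\<^sub>E {0<..}. int (\<Sum>a\<in>D. m a * x a) = q \<and> (\<forall>a\<in>D. x (v a) = x a)} =
    denumerant (D // orbit_rel v D) (\<lambda>c. \<Sum>a\<in>c. m a) q"
  unfolding denumerant_def
proof (rule bij_betw_same_card)
  define R where "R = orbit_rel v D"
  have R: "equiv D R" unfolding R_def by (rule equiv_orbit_rel)
  let ?X = "{x \<in> D \<rightarrow>\<^sub>E {0<..}. int (\<Sum>a\<in>D. m a * x a) = q \<and> (\<forall>a\<in>D. x (v a) = x a)}"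
  let ?Y = "{x \<in> D // R \<rightarrow>\<^sub>E {0<..}. int (\<Sum>c\<in>D // R. (\<Sum>a\<in>c. m a) * x c) = q}"
  define F where "F f = (\<lambda>a\<in>D. f (R `` {a}))" for f :: "'b set \<Rightarrow> nat"
  define G where "G x = (\<lambda>c\<in>D // R. x (SOME a. a \<in> c))" for x :: "'b \<Rightarrow> nat"
  have some: "(SOME a. a \<in> c) \<in> c" if "c \<in> D // R" for c
    using in_quotient_imp_non_empty [OF R that] by (simp add: some_in_eq)
  have class_eq: "R `` {a} = c" if "c \<in> D // R" "a \<in> c" for a c
    using that R by (metis Image_singleton_iff equiv_class_eq_iff quotientE)
  have sub: "c \<subseteq> D" if "c \<in> D // R" for c using in_quotient_imp_subset [OF R that] .
  have sumF: "(\<Sum>a\<in>D. m a * F f a) = (\<Sum>c\<in>D // R. (\<Sum>a\<in>c. m a) * f c)" for f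
  proof -
    have "(\<Sum>a\<in>D. m a * F f a) = (\<Sum>c\<in>D // R. \<Sum>a\<in>c. m a * F f a)"
      by (rule sum_over_quotient [OF D R, symmetric])
    also have "\<dots> = (\<Sum>c\<in>D // R. \<Sum>a\<in>c. m a * f c)"
    proof (intro sum.cong refl)
      fix c a assume "c \<in> D // R" "a \<in> c"
      then show "m a * F f a = m a * f c"
        using class_eq sub by (auto simp: F_def)
    qed
    finally show ?thesis by (simp add: sum_distrib_right)
  qed
  have GF: "G (F f) = f" if "f \<in> D // R \<rightarrow>\<^sub>E {0<..}" for f
  proof
    fix c show "G (F f) c = f c"
    proof (cases "c \<in> D // R")
      case True
      then show ?thesis using some [OF True] sub [OF True] class_eq [OF True] by (auto simp: G_def F_def)
    next
      case False
      then show ?thesis using that by (auto simp: G_def PiE_def extensional_def)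
    qed
  qed
  have FG: "F (G x) = x" if x: "x \<in> ?X" for x
  proof
    fix a show "F (G x) a = x a"
    proof (cases "a \<in> D")
      case True
      then have c: "R `` {a} \<in> D // R" by (rule quotientI)
      from some [OF c] have "(a, SOME b. b \<in> R `` {a}) \<in> R" by (simp only: Image_singleton_iff)
      then have rel: "(a, SOME b. b \<in> R `` {a}) \<in> orbit_rel v D" by (simp only: R_def)
      have "x (v b) = x b" if "b \<in> D" for b using x that by blast
      then have "x a = x (SOME b. b \<in> R `` {a})"
        by (rule orbit_rel_invariant [of D x v, OF _ rel])
      then show ?thesis using True c by (simp add: F_def G_def)
    next
      case False
      then show ?thesis using x by (auto simp: F_def PiE_def extensional_def)
    qed
  qed
  have "bij_betw F ?Y ?X"
  proof (rule bij_betw_byWitness [where f' = G])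
    show "\<forall>f\<in>?Y. G (F f) = f" using GF by blast
    show "\<forall>x\<in>?X. F (G x) = x" using FG by blast
    show "F ` ?Y \<subseteq> ?X"
    proof (intro image_subsetI)
      fix f assume f: "f \<in> ?Y"
      have "F f (v a) = F f a" if a: "a \<in> D" for a
      proof -
        have "R `` {a} = R `` {v a}"
          using equiv_class_eq [OF R] orbit_rel_image [OF v a] by (simp add: R_def)
        moreover have "v a \<in> D" using v a by blast
        ultimately show ?thesis using a by (simp add: F_def)
      qed
      moreover have "F f \<in> D \<rightarrow>\<^sub>E {0<..}"
        using f quotientI [of _ D R] by (auto simp: F_def PiE_iff)
      moreover have "int (\<Sum>a\<in>D. m a * F f a) = q" using f unfolding sumF by blast
      ultimately show "F f \<in> ?X" by blast
    qed
    show "G ` ?X \<subseteq> ?Y"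
    proof (intro image_subsetI)
      fix x assume x: "x \<in> ?X"
      have "G x \<in> D // R \<rightarrow>\<^sub>E {0<..}"
        using x some sub by (fastforce simp: G_def PiE_iff)
      moreover have "(\<Sum>c\<in>D // R. (\<Sum>a\<in>c. m a) * G x c) = (\<Sum>a\<in>D. m a * x a)"
        using sumF [of "G x"] FG [OF x] by simp
      then have "int (\<Sum>c\<in>D // R. (\<Sum>a\<in>c. m a) * G x c) = q" using x by (simp only: mem_Collect_eq)
      ultimately show "G x \<in> ?Y" by blast
    qed
  qed
  then have "bij_betw (the_inv_into ?Y F) ?X ?Y" by (rule bij_betw_the_inv_into)
  then show "bij_betw (the_inv_into ?Y F) ?X
    {x \<in> D // orbit_rel v D \<rightarrow>\<^sub>E {0<..}. int (\<Sum>c\<in>D // orbit_rel v D. (\<Sum>a\<in>c. m a) * x c) = q}"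
    by (simp only: R_def)
qed

context based_root_system
begin

section \<open>Fixed points of a diagram automorphism\<close>

definition diagram_orbits :: "('a \<Rightarrow> 'a) \<Rightarrow> 'a set set" where
  "diagram_orbits v = extended_base // orbit_rel v extended_base"

definition orbit_mark :: "'a set \<Rightarrow> nat" where
  "orbit_mark c = (\<Sum>a\<in>c. mark a)"

lemma finite_diagram_orbits: "finite (diagram_orbits v)"
  and diagram_orbits_nonempty: "diagram_orbits v \<noteq> {}"
  and diagram_orbits_subset: "c \<in> diagram_orbits v \<Longrightarrow> c \<subseteq> extended_base"
  and sum_orbit_mark: "sum orbit_mark (diagram_orbits v) = sum mark extended_base"
proof -
  note R = equiv_orbit_rel [of extended_base v]
  show "finite (diagram_orbits v)"
    unfolding diagram_orbits_def by (rule finite_quotient [OF finite_extended_base equiv_type [OF R]])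
  show "diagram_orbits v \<noteq> {}"
    unfolding diagram_orbits_def quotient_is_empty by (simp add: extended_base_def)
  show "c \<in> diagram_orbits v \<Longrightarrow> c \<subseteq> extended_base"
    unfolding diagram_orbits_def by (rule in_quotient_imp_subset [OF R])
  show "sum orbit_mark (diagram_orbits v) = sum mark extended_base"
    unfolding diagram_orbits_def orbit_mark_def by (rule sum_over_quotient [OF finite_extended_base R])
qed

lemma orbit_mark_pos:
  assumes "c \<in> diagram_orbits v"
  shows "orbit_mark c > 0"
proof -
  have "c \<noteq> {}"
    using assms in_quotient_imp_non_empty [OF equiv_orbit_rel] by (auto simp: diagram_orbits_def)
  then show ?thesis
    unfolding orbit_mark_def
    using diagram_orbits_subset [OF assms] mark_pos finite_extended_base finite_subset
    by (intro sum_pos) blast+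
qed

lemma diagram_group_fixed_iff:
  assumes v: "v \<in> diagram_group" and q: "q > 0" and y: "y \<in> alcove_points q"
  shows "lattice_cong q (v y) y \<longleftrightarrow> (\<forall>a\<in>extended_base. resid q y (v a) = resid q y a)"
proof
  have vW: "v \<in> W" using v by (simp add: diagram_group_def)
  have vD: "v a \<in> extended_base" "inv v a \<in> extended_base" if "a \<in> extended_base" for a
    using v diagram_group_inv [OF v] that by (auto simp: diagram_group_def)
  {
    assume "lattice_cong q (v y) y"
    then have cong: "lattice_cong q y (v y)" by (rule lattice_cong_sym)
    show "\<forall>a\<in>extended_base. resid q y (v a) = resid q y a"
      using resid_cong [OF y y vW cong extended_base_root [OF vD(1)]]
      by (simp add: weyl_group_inv_cancel [OF vW])
  }
  assume *: "\<forall>a\<in>extended_base. resid q y (v a) = resid q y a"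
  show "lattice_cong q (v y) y"
  proof (rule lattice_congI [OF q])
    fix \<alpha> assume a: "\<alpha> \<in> \<Delta>"
    then have "resid q y \<alpha> = resid q y (inv v \<alpha>)"
      using * vD(2) [of \<alpha>] weyl_group_inv_cancel(1) [OF vW] by (metis extended_base_def insertI2)
    then have "\<alpha> \<bullet> v y = \<alpha> \<bullet> y + of_int q * of_int (- int (shift (inv v \<alpha>)))"
      using a by (simp add: resid_def shift_base weyl_group_adjoint [OF vW])
    then show "\<exists>k::int. \<alpha> \<bullet> v y = \<alpha> \<bullet> y + of_int q * of_int k" ..
  qed
qed

text \<open>The residues identify the fixed points with the invariant positive integer functions on the
  extended base whose sum weighted by the marks is \<open>q\<close>.\<close>

lemma card_alcove_fixed:
  assumes v: "v \<in> diagram_group" and q: "q > 0"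
  shows "card {y \<in> alcove_points q. lattice_cong q (v y) y} =
    denumerant (diagram_orbits v) orbit_mark q"
proof -
  have vD: "v ` extended_base \<subseteq> extended_base" using v by (simp add: diagram_group_def)
  let ?S = "{y \<in> alcove_points q. lattice_cong q (v y) y}"
  let ?X = "{x \<in> extended_base \<rightarrow>\<^sub>E {0<..}. int (\<Sum>a\<in>extended_base. mark a * x a) = q \<and>
    (\<forall>a\<in>extended_base. x (v a) = x a)}"
  let ?F = "\<lambda>y. \<lambda>a\<in>extended_base. nat \<lfloor>resid q y a\<rfloor>"
  have real: "real (nat \<lfloor>resid q y a\<rfloor>) = resid q y a"
    if "y \<in> alcove_points q" "a \<in> extended_base" for y a
  proof -
    have "a \<bullet> y \<in> \<int>"
      using that extended_base_root by (auto simp: alcove_points_def coweight_lattice_def)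
    then have "resid q y a \<in> \<int>" by (auto simp: resid_def)
    then obtain k where "resid q y a = of_int k" by (auto elim: Ints_cases)
    moreover have "resid q y a > 0" using that by (auto simp: alcove_points_def)
    ultimately show ?thesis by simp
  qed
  have "bij_betw ?F ?S ?X"
    unfolding bij_betw_def
  proof
    show "inj_on ?F ?S"
    proof (rule inj_onI, rule resid_inj [of q])
      fix y y' a assume y: "y \<in> ?S" "y' \<in> ?S" "?F y = ?F y'" and a: "a \<in> extended_base"
      have "nat \<lfloor>resid q y a\<rfloor> = nat \<lfloor>resid q y' a\<rfloor>"
        using y(3) a by (metis (no_types, lifting) restrict_apply')
      then show "resid q y a = resid q y' a"
        using real [of y a] real [of y' a] y a by (metis (no_types, lifting) mem_Collect_eq)
    qed
    show "?F ` ?S = ?X"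
    proof (intro equalityI image_subsetI subsetI)
      fix y assume "y \<in> ?S"
      then have y: "y \<in> alcove_points q" and fixed: "lattice_cong q (v y) y" by auto
      have "real (\<Sum>a\<in>extended_base. mark a * ?F y a) =
          (\<Sum>a\<in>extended_base. real (mark a) * resid q y a)"
        using real [OF y] by simp
      also have "\<dots> = real_of_int q" by (rule resid_sum)
      finally have "real_of_int (int (\<Sum>a\<in>extended_base. mark a * ?F y a)) = real_of_int q"
        by (simp only: of_int_of_nat_eq)
      then have "int (\<Sum>a\<in>extended_base. mark a * ?F y a) = q" by (simp only: of_int_eq_iff)
      moreover have "?F y \<in> extended_base \<rightarrow>\<^sub>E {0<..}"
      proof -
        have "nat \<lfloor>resid q y a\<rfloor> > 0" if "a \<in> extended_base" for a
          using real [OF y that] y that by (auto simp: alcove_points_def simp flip: of_nat_0_less_iff [where 'a = real])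
        then show ?thesis by auto
      qed
      moreover have "?F y (v a) = ?F y a" if "a \<in> extended_base" for a
        using diagram_group_fixed_iff [OF v q y] fixed that vD by (auto simp: image_subset_iff)
      ultimately show "?F y \<in> ?X" by blast
    next
      fix x assume x: "x \<in> ?X"
      have "(\<Sum>a\<in>extended_base. real (mark a) * real (x a)) = of_int q"
        using x by (auto simp flip: of_nat_mult of_nat_sum)
      then obtain y where y: "\<And>a. a \<in> extended_base \<Longrightarrow> resid q y a = real (x a)"
        using resid_surj [of "\<lambda>a. real (x a)"] by blast
      have "\<alpha> \<bullet> y \<in> \<int>" if "\<alpha> \<in> \<Delta>" for \<alpha>
        using y [of \<alpha>] that by (simp add: extended_base_def resid_def shift_base)
      then have "y \<in> Z" by (simp add: coweight_lattice_iff)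
      moreover have "x a > 0" if "a \<in> extended_base" for a
        using x that by (auto dest: PiE_mem)
      ultimately have yA: "y \<in> alcove_points q" using y by (simp add: alcove_points_def)
      have "\<forall>a\<in>extended_base. resid q y (v a) = resid q y a"
        using y x vD by (auto simp: image_subset_iff)
      then have "y \<in> ?S" using yA diagram_group_fixed_iff [OF v q yA] by blast
      moreover have "x = ?F y"
      proof
        fix a
        show "x a = ?F y a"
          using x y by (cases "a \<in> extended_base") (auto simp: PiE_def extensional_def)
      qed
      ultimately show "x \<in> ?F ` ?S" by blast
    qed
  qed
  then have "card ?S = card ?X" by (rule bij_betw_same_card)
  also have "\<dots> = denumerant (diagram_orbits v) orbit_mark q"
    unfolding diagram_orbits_def orbit_mark_def
    by (rule card_invariant_functions [OF finite_extended_base vD])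
  finally show ?thesis .
qed

lemma fixed_space_iff:
  assumes v: "v \<in> diagram_group"
  shows "v x = x \<longleftrightarrow> (\<forall>a\<in>extended_base. v a \<bullet> x = a \<bullet> x)"
proof
  have vW: "v \<in> W" using v by (simp add: diagram_group_def)
  show "\<forall>a\<in>extended_base. v a \<bullet> x = a \<bullet> x" if "v x = x"
    using weyl_group_inner [OF vW, of _ x] that by simp
  assume *: "\<forall>a\<in>extended_base. v a \<bullet> x = a \<bullet> x"
  show "v x = x"
  proof (rule inner_base_inj)
    fix \<alpha> assume "\<alpha> \<in> \<Delta>"
    then obtain a where "a \<in> extended_base" "\<alpha> = v a"
      using v by (auto simp: diagram_group_def extended_base_def)
    then show "\<alpha> \<bullet> v x = \<alpha> \<bullet> x" using * weyl_group_inner [OF vW] by simp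
  qed
qed

text \<open>A vector \<open>x\<close> is determined by the numbers \<open>a \<bullet> x\<close> for \<open>a\<close> in the extended base. Fixed vectors are
  those for which these numbers are constant on orbits, and the only constraint is that their sum
  weighted by the marks vanishes. Hence the values on all orbits but one, say that of \<open>- \<theta>\<close>, are free,
  which yields an explicit basis indexed by the other orbits.\<close>

lemma dim_fixed_space:
  assumes v: "v \<in> diagram_group"
  shows "dim {x. v x = x} = card (diagram_orbits v) - 1"
proof -
  define R where "R = orbit_rel v extended_base"
  have R: "equiv extended_base R" unfolding R_def by (rule equiv_orbit_rel)
  have vD: "v ` extended_base \<subseteq> extended_base" using v by (simp add: diagram_group_def)
  have top: "- \<theta> \<in> extended_base" by (simp add: extended_base_def)
  define C where "C = diagram_orbits v"
  have C: "C = extended_base // R" by (simp add: C_def diagram_orbits_def R_def)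
  define c0 where "c0 = R `` {- \<theta>}"
  have c0: "c0 \<in> C" unfolding c0_def C using top by (rule quotientI)
  have finC: "finite C" unfolding C_def by (rule finite_diagram_orbits)
  have finc: "finite c" if "c \<in> C" for c
    using diagram_orbits_subset that finite_extended_base finite_subset unfolding C_def by metis
  have subc: "c \<subseteq> extended_base" if "c \<in> C" for c
    using diagram_orbits_subset that unfolding C_def by metis
  have disj: "c = d" if "c \<in> C" "d \<in> C" "a \<in> c" "a \<in> d" for c d a
    using quotient_disj [OF R, of c d] that unfolding C by blast
  have closed: "v a \<in> c \<longleftrightarrow> a \<in> c" if "c \<in> C" "a \<in> extended_base" for a c
  proof -
    have "R `` {a} = R `` {v a}"
      using equiv_class_eq [OF R] orbit_rel_image [OF vD that(2)] by (simp add: R_def)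
    then have "a \<in> R `` {a}" "v a \<in> R `` {a}"
      using equiv_class_self [OF R] that(2) vD by (auto simp: image_subset_iff)
    moreover have "R `` {a} \<in> C" unfolding C using that(2) by (rule quotientI)
    ultimately show ?thesis using disj that(1) by metis
  qed
  have m0: "orbit_mark c0 > 0" using orbit_mark_pos c0 unfolding C_def by blast
  define f where "f c a = (if a \<in> c then 1
    else if a \<in> c0 then - (real (orbit_mark c) / real (orbit_mark c0)) else 0)" for c a
  have sumc: "(\<Sum>a\<in>extended_base. if a \<in> c then real (mark a) * r else 0) = real (orbit_mark c) * r"
    if "c \<in> C" for c r
  proof -
    have "(\<Sum>a\<in>extended_base. if a \<in> c then real (mark a) * r else 0) =
        (\<Sum>a\<in>extended_base \<inter> c. real (mark a) * r)"
      using finite_extended_base by (simp add: sum.inter_restrict)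
    also have "extended_base \<inter> c = c" using subc [OF that] by blast
    finally show ?thesis by (simp add: orbit_mark_def sum_distrib_right)
  qed
  have "\<exists>y. \<forall>a\<in>extended_base. a \<bullet> y = f c a" if c: "c \<in> C" "c \<noteq> c0" for c
  proof -
    have "real (mark a) * f c a = (if a \<in> c then real (mark a) * 1 else 0) +
        (if a \<in> c0 then real (mark a) * - (real (orbit_mark c) / real (orbit_mark c0)) else 0)" for a
      using disj [OF c(1) c0, of a] c(2) by (auto simp: f_def)
    then have "(\<Sum>a\<in>extended_base. real (mark a) * f c a) =
        real (orbit_mark c) * 1 + real (orbit_mark c0) * - (real (orbit_mark c) / real (orbit_mark c0))"
      by (simp only: sum.distrib sumc [OF c(1)] sumc [OF c0])
    also have "\<dots> = 0" using m0 by simp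
    finally have "(\<Sum>a\<in>extended_base. real (mark a) * f c a) = of_int 0" by simp
    then obtain y where "\<And>a. a \<in> extended_base \<Longrightarrow> resid 0 y a = f c a"
      using resid_surj by blast
    then show ?thesis by (auto simp: resid_def)
  qed
  then have "\<forall>c\<in>C - {c0}. \<exists>y. \<forall>a\<in>extended_base. a \<bullet> y = f c a" by blast
  from bchoice [OF this] obtain Y where
    "\<forall>c\<in>C - {c0}. \<forall>a\<in>extended_base. a \<bullet> Y c = f c a" ..
  then have Y: "\<And>c a. c \<in> C \<Longrightarrow> c \<noteq> c0 \<Longrightarrow> a \<in> extended_base \<Longrightarrow> a \<bullet> Y c = f c a"
    by blast
  have Y_value: "a \<bullet> Y d = (if d = c then 1 else 0)"
    if "c \<in> C - {c0}" "d \<in> C - {c0}" "a \<in> c" for a c d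
  proof -
    have cd: "c \<in> C" "c \<noteq> c0" "d \<in> C" "d \<noteq> c0" using that by auto
    have "a \<notin> c0" using disj [OF cd(1) c0 that(3)] cd(2) by blast
    moreover have "a \<in> d \<longleftrightarrow> d = c" using disj [OF cd(1,3) that(3)] that(3) by blast
    moreover have "a \<bullet> Y d = f d a" using Y [OF cd(3,4)] subc [OF cd(1)] that(3) by blast
    ultimately show ?thesis by (simp add: f_def)
  qed
  have nonempty: "\<exists>a. a \<in> c" if "c \<in> C" for c
    using that in_quotient_imp_non_empty [OF R] unfolding C by blast
  have inj: "inj_on Y (C - {c0})"
  proof (rule inj_onI)
    fix c d assume cd: "c \<in> C - {c0}" "d \<in> C - {c0}" "Y c = Y d"
    obtain a where "a \<in> c" using nonempty cd(1) by blast
    then show "c = d"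
      using Y_value [OF cd(1) cd(1)] Y_value [OF cd(1) cd(2)] cd(3) by (metis zero_neq_one)
  qed
  have "dim {x. v x = x} = card (Y ` (C - {c0}))"
  proof (rule dim_unique)
    show "Y ` (C - {c0}) \<subseteq> {x. v x = x}"
    proof clarify
      fix c assume c: "c \<in> C" "c \<noteq> c0"
      have "v a \<bullet> Y c = a \<bullet> Y c" if "a \<in> extended_base" for a
        using that vD closed [OF c(1) that] closed [OF c0 that]
        by (simp add: Y [OF c] f_def image_subset_iff)
      then show "v (Y c) = Y c" using fixed_space_iff [OF v] by blast
    qed
    show "{x. v x = x} \<subseteq> span (Y ` (C - {c0}))"
    proof
      fix x assume "x \<in> {x. v x = x}"
      then have inv: "\<And>a. a \<in> extended_base \<Longrightarrow> v a \<bullet> x = a \<bullet> x"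
        using fixed_space_iff [OF v] by blast
      have const: "a \<bullet> x = b \<bullet> x" if "c \<in> C" "a \<in> c" "b \<in> c" for a b c
      proof (rule orbit_rel_invariant [of extended_base "\<lambda>a. a \<bullet> x" v])
        show "(a, b) \<in> orbit_rel v extended_base"
          using quotient_eq_iff [OF R, of c c a b] that unfolding C R_def by blast
      qed (rule inv)
      define g where "g c = (SOME a. a \<in> c) \<bullet> x" for c
      have g: "a \<bullet> x = g c" if "c \<in> C" "a \<in> c" for a c
        unfolding g_def using const [OF that(1,2)] that(2) by (metis someI)
      define z where "z = x - (\<Sum>c\<in>C - {c0}. g c *\<^sub>R Y c)"
      have z0: "a \<bullet> z = 0" if "c \<in> C - {c0}" "a \<in> c" for a c
      proof -
        have "(\<Sum>d\<in>C - {c0}. g d * (a \<bullet> Y d)) = (\<Sum>d\<in>C - {c0}. if d = c then g d else 0)"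
          using Y_value [OF that(1) _ that(2)] by (intro sum.cong refl) simp
        also have "\<dots> = g c" using that(1) finC by simp
        finally show ?thesis
          using g [of c a] that by (simp add: z_def inner_diff_right inner_sum_right)
      qed
      have zc: "a \<bullet> z = - \<theta> \<bullet> z" if a: "a \<in> c0" for a
      proof -
        have "a \<bullet> Y d = - \<theta> \<bullet> Y d" if d: "d \<in> C - {c0}" for d
        proof -
          have "b \<bullet> Y d = - (real (orbit_mark d) / real (orbit_mark c0))" if "b \<in> c0" for b
          proof -
            have "b \<notin> d" using that d disj [OF _ c0, of d b] by blast
            moreover have "b \<in> extended_base" using subc [OF c0] that by blast
            ultimately show ?thesis using d that by (simp add: Y f_def)
          qed
          then show ?thesis using a equiv_class_self [OF R top] unfolding c0_def by metis
        qed
        moreover have "a \<bullet> x = - \<theta> \<bullet> x"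
          using const [OF c0 a] equiv_class_self [OF R top] unfolding c0_def by blast
        ultimately show ?thesis
          by (simp only: z_def inner_diff_right inner_sum_right inner_scaleR_right cong: sum.cong)
      qed
      have "(\<Sum>a\<in>extended_base. real (mark a) * (a \<bullet> z)) =
          (\<Sum>a\<in>extended_base. if a \<in> c0 then real (mark a) * (- \<theta> \<bullet> z) else 0)"
      proof (rule sum.cong [OF refl])
        fix a assume a: "a \<in> extended_base"
        have "R `` {a} \<in> C" "a \<in> R `` {a}"
          using a equiv_class_self [OF R] unfolding C by (auto intro: quotientI)
        then show "real (mark a) * (a \<bullet> z) = (if a \<in> c0 then real (mark a) * (- \<theta> \<bullet> z) else 0)"
          using zc [of a] z0 [of "R `` {a}" a] by auto
      qed
      then have "real (orbit_mark c0) * (- \<theta> \<bullet> z) = 0"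
        unfolding sumc [OF c0] mark_relation_inner by simp
      then have "- \<theta> \<bullet> z = 0" using m0 by simp
      have "z = 0"
      proof (rule inner_base_inj)
        fix \<alpha> assume "\<alpha> \<in> \<Delta>"
        then have a: "\<alpha> \<in> extended_base" by (simp add: extended_base_def)
        have "R `` {\<alpha>} \<in> C" "\<alpha> \<in> R `` {\<alpha>}"
          using a equiv_class_self [OF R] unfolding C by (auto intro: quotientI)
        then show "\<alpha> \<bullet> z = \<alpha> \<bullet> 0"
          using zc [of \<alpha>] z0 [of "R `` {\<alpha>}" \<alpha>] \<open>- \<theta> \<bullet> z = 0\<close> by auto
      qed
      then have "x = (\<Sum>c\<in>C - {c0}. g c *\<^sub>R Y c)" by (simp add: z_def)
      then show "x \<in> span (Y ` (C - {c0}))"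
        by (auto intro!: span_sum span_scale intro: span_base)
    qed
    show "independent (Y ` (C - {c0}))"
    proof (rule independent_if_scalars_zero)
      show "finite (Y ` (C - {c0}))" using finC by simp
      fix r y assume sum0: "(\<Sum>x\<in>Y ` (C - {c0}). r x *\<^sub>R x) = 0" and "y \<in> Y ` (C - {c0})"
      then obtain c where c: "c \<in> C - {c0}" "y = Y c" by blast
      obtain a where a: "a \<in> c" using nonempty c(1) by blast
      have "(\<Sum>d\<in>C - {c0}. r (Y d) *\<^sub>R Y d) = 0"
        using sum0 by (simp add: sum.reindex [OF inj])
      then have "0 = a \<bullet> (\<Sum>d\<in>C - {c0}. r (Y d) *\<^sub>R Y d)" by simp
      also have "\<dots> = (\<Sum>d\<in>C - {c0}. if d = c then r (Y d) else 0)"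
        unfolding inner_sum_right using Y_value [OF c(1) _ a] by (intro sum.cong refl) simp
      also have "\<dots> = r y" using c finC by simp
      finally show "r y = 0" by simp
    qed
  qed simp
  also have "\<dots> = card C - 1" using inj c0 finC by (simp add: card_image)
  finally show ?thesis by (simp add: C_def)
qed

section \<open>Reciprocity for the permutation character\<close>

text \<open>Outside the diagram group no point is fixed, and the zero quasi-polynomial satisfies the
  reciprocity with any sign; so the sign can be stated uniformly in terms of the fixed space of \<open>v\<close>.\<close>

lemma conjugate_count_reciprocity:
  assumes v: "v \<in> W"
  shows "\<exists>g. quasi_polynomial g \<and>
    (\<forall>q>0. g q = of_nat (card {y \<in> alcove_points q. lattice_cong q (v y) y})) \<and>
    (\<forall>q. g (int (sum mark extended_base) - q) = (-1) ^ dim {x. v x = x} * g q)"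
proof (cases "v \<in> diagram_group")
  case True
  obtain g where "quasi_polynomial g"
    and "\<forall>q>0. g q = of_nat (denumerant (diagram_orbits v) orbit_mark q)"
    and "\<forall>q. g (int (sum orbit_mark (diagram_orbits v)) - q) =
      (-1) ^ (card (diagram_orbits v) - 1) * g q"
    using denumerant_reciprocity [of "diagram_orbits v" orbit_mark,
        OF finite_diagram_orbits diagram_orbits_nonempty orbit_mark_pos [of _ v]]
    by blast
  then show ?thesis
    using card_alcove_fixed [OF True]
    by (intro exI [of _ g]) (simp add: sum_orbit_mark dim_fixed_space [OF True])
next
  case False
  have none: "{y \<in> alcove_points q. lattice_cong q (v y) y} = {}" for q
    using diagram_groupI [OF _ _ v] lattice_cong_sym False by blast
  show ?thesis
    unfolding none by (intro exI [of _ "\<lambda>q. 0"]) (simp add: quasi_polynomial_zero)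
qed

lemma dim_conjugate_fixed_space:
  assumes u: "u \<in> W" and w: "w \<in> W"
  shows "dim {x. (inv u \<circ> w \<circ> u) x = x} = dim {x. w x = x}"
proof -
  have "{x. w x = x} = u ` {x. (inv u \<circ> w \<circ> u) x = x}"
  proof (intro equalityI subsetI)
    fix x assume "x \<in> {x. w x = x}"
    then have "inv u x \<in> {x. (inv u \<circ> w \<circ> u) x = x}" "x = u (inv u x)"
      using weyl_group_inv_cancel [OF u] by simp_all
    then show "x \<in> u ` {x. (inv u \<circ> w \<circ> u) x = x}" by (rule rev_image_eqI)
  next
    fix x assume "x \<in> u ` {x. (inv u \<circ> w \<circ> u) x = x}"
    then obtain z where "inv u (w (u z)) = z" "x = u z" by auto
    then show "x \<in> {x. w x = x}" using weyl_group_inv_cancel(1) [OF u, of "w (u z)"] by simp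
  qed
  moreover have "dim (u ` S) = dim S" for S
    using weyl_group_linear [OF u] weyl_group_bij [OF u]
    by (intro dim_image_eq) (auto intro: inj_on_subset bij_is_inj)
  ultimately show ?thesis by simp
qed

text \<open>The conjugates of \<open>w\<close> have fixed spaces of the same dimension, so the reciprocities of the summands
  carry the same sign and can be added.\<close>

lemma fixed_count_reciprocity:
  assumes w: "w \<in> W"
  shows "\<exists>g. quasi_polynomial g \<and> (\<forall>q>0. g q = of_nat (fixed_count \<Phi> q w)) \<and>
    (\<forall>q. g (int (sum mark extended_base) - q) = (-1) ^ dim {x. w x = x} * g q)"
proof -
  have conj: "inv u \<circ> w \<circ> u \<in> W" if "u \<in> W" for u
    using that w weyl_group_compose weyl_group_inv by blast
  have "\<forall>u\<in>W. \<exists>g. quasi_polynomial g \<and>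
      (\<forall>q>0. g q = of_nat (card {y \<in> alcove_points q. lattice_cong q ((inv u \<circ> w \<circ> u) y) y})) \<and>
      (\<forall>q. g (int (sum mark extended_base) - q) = (-1) ^ dim {x. w x = x} * g q)"
  proof
    fix u assume u: "u \<in> W"
    from conjugate_count_reciprocity [OF conj [OF u]]
    show "\<exists>g. quasi_polynomial g \<and>
      (\<forall>q>0. g q = of_nat (card {y \<in> alcove_points q. lattice_cong q ((inv u \<circ> w \<circ> u) y) y})) \<and>
      (\<forall>q. g (int (sum mark extended_base) - q) = (-1) ^ dim {x. w x = x} * g q)"
      unfolding dim_conjugate_fixed_space [OF u w] .
  qed
  from bchoice [OF this]
  obtain G where quasi: "\<And>u. u \<in> W \<Longrightarrow> quasi_polynomial (G u)"
    and count: "\<And>u q. u \<in> W \<Longrightarrow> q > 0 \<Longrightarrow>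
      G u q = of_nat (card {y \<in> alcove_points q. lattice_cong q ((inv u \<circ> w \<circ> u) y) y})"
    and rec: "\<And>u q. u \<in> W \<Longrightarrow>
      G u (int (sum mark extended_base) - q) = (-1) ^ dim {x. w x = x} * G u q"
    by blast
  have "finite diagram_group"
    by (rule finite_subset [OF _ finite_weyl_group [OF root_system]]) (auto simp: diagram_group_def)
  moreover have "id \<in> diagram_group" by (simp add: diagram_group_def weyl_group.weyl_id)
  ultimately have nz: "card diagram_group \<noteq> 0" by auto
  define g where "g q = (1 / of_nat (card diagram_group)) * (\<Sum>u\<in>W. G u q)" for q
  have "quasi_polynomial g"
    unfolding g_def by (intro quasi_polynomial_cmult quasi_polynomial_sum quasi)
  moreover have "g q = of_nat (fixed_count \<Phi> q w)" if "q > 0" for q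
  proof -
    have "(\<Sum>u\<in>W. G u q) = of_nat (card diagram_group * fixed_count \<Phi> q w)"
      unfolding fixed_count_alcove [OF that w] using count [OF _ that] by simp
    then show ?thesis using nz by (simp add: g_def)
  qed
  moreover have "g (int (sum mark extended_base) - q) = (-1) ^ dim {x. w x = x} * g q" for q
  proof -
    have "(\<Sum>u\<in>W. G u (int (sum mark extended_base) - q)) =
        (\<Sum>u\<in>W. (-1) ^ dim {x. w x = x} * G u q)"
      by (intro sum.cong refl rec)
    then show ?thesis by (simp add: g_def sum_distrib_left mult.left_commute)
  qed
  ultimately show ?thesis by blast
qed

lemma coxeter_number_eq_sum_marks:
  assumes "\<theta> = (\<Sum>\<alpha>\<in>\<Delta>. of_int (n \<alpha>) *\<^sub>R \<alpha>)"
  shows "1 + (\<Sum>\<alpha>\<in>\<Delta>. n \<alpha>) = int (sum mark extended_base)"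
proof -
  have "int (mark \<alpha>) = n \<alpha>" if "\<alpha> \<in> \<Delta>" for \<alpha>
  proof -
    have "real (mark \<alpha>) = real_of_int (n \<alpha>)"
      using coefficient [OF that, of "\<lambda>\<alpha>. of_int (n \<alpha>)"] assms real_mark [OF that] by simp
    then show ?thesis by linarith
  qed
  then show ?thesis by (simp add: sum_extended_base mark_minus_highest)
qed

end

lemma chi_eq_quasi_polynomial:
  assumes "quasi_polynomial g" "\<And>q. q > 0 \<Longrightarrow> g q = of_nat (fixed_count \<Phi> q w)"
  shows "chi \<Phi> q w = g q"
proof (cases "q > 0")
  case False
  have "(THE g. quasi_polynomial g \<and> (\<forall>p>0. g p = of_nat (fixed_count \<Phi> p w))) = g"
    using assms by (intro the_equality) (auto intro: quasi_polynomial_eqI)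
  with False show ?thesis by (simp add: chi_def)
qed (simp add: chi_def assms(2))

lemma delta_sign:
  fixes w :: "'a::euclidean_space \<Rightarrow> 'a"
  shows "(-1) ^ DIM('a) * delta w = (-1) ^ dim {x. w x = x}"
proof -
  let ?d = "dim {x. w x = x}"
  have "?d \<le> DIM('a)" by (rule dim_subset_UNIV)
  then have "DIM('a) + (DIM('a) - ?d) = 2 * (DIM('a) - ?d) + ?d" by linarith
  then have "(-1) ^ DIM('a) * (-1) ^ (DIM('a) - ?d) = ((-1) ^ (2 * (DIM('a) - ?d) + ?d) :: complex)"
    by (simp only: flip: power_add)
  also have "\<dots> = (-1) ^ ?d" by (simp add: power_add power_mult)
  finally show ?thesis by (simp only: delta_def)
qed

theorem theorem1p1:
  fixes \<Phi> :: "'a::euclidean_space set" and h :: int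
  assumes "root_system \<Phi>" and "reduced_roots \<Phi>" and "irreducible_roots \<Phi>"
    and "is_coxeter_number \<Phi> h"
  shows "\<forall>w\<in>weyl_group \<Phi>. \<forall>q::int.
           chi \<Phi> q w = (-1) ^ DIM('a) * delta w * chi \<Phi> (h - q) w"
proof (intro ballI allI)
  fix w q assume w: "w \<in> weyl_group \<Phi>"
  obtain \<Delta> \<theta> and n :: "'a \<Rightarrow> int" where simple: "simple_roots \<Phi> \<Delta>"
    and highest: "highest_root \<Phi> \<Delta> \<theta>" and \<theta>: "\<theta> = (\<Sum>\<alpha>\<in>\<Delta>. of_int (n \<alpha>) *\<^sub>R \<alpha>)"
    and h: "h = 1 + (\<Sum>\<alpha>\<in>\<Delta>. n \<alpha>)"
    using assms(4) unfolding is_coxeter_number_def by blast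
  interpret based_root_system \<Phi> \<Delta> \<theta>
    using assms(1) simple highest by unfold_locales
  obtain g where g: "quasi_polynomial g" "\<And>q. q > 0 \<Longrightarrow> g q = of_nat (fixed_count \<Phi> q w)"
    and rec: "\<And>q. g (int (sum mark extended_base) - q) = (-1) ^ dim {x. w x = x} * g q"
    using fixed_count_reciprocity [OF w] by blast
  have chi: "chi \<Phi> p w = g p" for p
    by (rule chi_eq_quasi_polynomial [OF g(1)]) (rule g(2))
  have "h - q = int (sum mark extended_base) - q"
    unfolding h coxeter_number_eq_sum_marks [OF \<theta>] ..
  then have "g (h - q) = (-1) ^ dim {x. w x = x} * g q" using rec by simp
  then have "g q = (-1) ^ dim {x. w x = x} * g (h - q)"
    by (simp flip: power_mult_distrib mult.assoc)
  then show "chi \<Phi> q w = (-1) ^ DIM('a) * delta w * chi \<Phi> (h - q) w"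
    by (simp only: delta_sign chi)
qed

end
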